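(* Let $W$ be a linear family of bisectors that is not a confocal 3- or 4-dimensional linear family with negative common focus. Then the base $B_W$ completely determines $W$, since $$W=\big\{h\in\mathrm{Lin}_{\mathbb C}(V,V)\ \big|\ \operatorname{tr}h=0,\ h^*=h,\ \langle hb,b\rangle=0\text{ for all }b\in B_W\big\}.$$
   Context: $V$ is a 3-dimensional $\mathbb C$-linear space with a hermitian form $\langle-,-\rangle$ (linear in the first argument) of signature $++-$. $\mathbb B=\{p\in\mathbb P_{\mathbb C}V\mid\langle p,p\rangle<0\}$ is the set of negative points. $\mathrm{Lin}_{\mathbb C}(V,V)$ is the space of $\mathbb C$-linear maps $V\to V$; $h^*$ is the adjoint of $h$ with respect to $\langle-,-\rangle$. A family of bisectors is an $\mathbb R$-linear subspace $W\subset\mathrm{Lin}_{\mathbb C}(V,V)$ such that $\operatorname{tr}h=0$ and $h^*=h$ for all $h\in W$, $W$ is the $\mathbb R$-span of $D_W:=\{h\in W\mid\det h=0\}$, and $B_W\cap\mathbb B\ne\varnothing$, where $B_W:=\{p\in\mathbb P_{\mathbb C}V\mid\langle hp,p\rangle=0\text{ for all }h\in W\}$ is the base of the family. The family is linear if $D_W=W$ (then every $0\ne h\in W$ has rank 2). A linear family $W$ is confocal with common focus $f_0\in\mathbb P_{\mathbb C}V$ if $Wf_0=0$; the common focus is negative if $f_0\in\mathbb B$. *)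

theory Defs
  imports "HOL-Analysis.Analysis" "HOL-Library.Function_Algebras"
begin

text \<open>
  Real scaling of maps \<open>V \<rightarrow> V\<close> on a complex vector space; addition of maps is the pointwise one
  of \<^theory>\<open>HOL-Library.Function_Algebras\<close>.
\<close>

definition map_scaleR :: "(complex \<Rightarrow> 'v \<Rightarrow> 'v) \<Rightarrow> real \<Rightarrow> ('v \<Rightarrow> 'v) \<Rightarrow> 'v \<Rightarrow> 'v"
  where "map_scaleR scl r h = (\<lambda>v. scl (complex_of_real r) (h v))"

locale complex_space_3 = vector_space scale
  for scale :: "complex \<Rightarrow> 'v::ab_group_add \<Rightarrow> 'v" +
  assumes dim_UNIV: "dim (UNIV :: 'v set) = 3"
begin

definition Lin :: "('v \<Rightarrow> 'v) set"
  where "Lin = {h. Vector_Spaces.linear scale scale h}"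

definition is_basis :: "(3 \<Rightarrow> 'v) \<Rightarrow> bool"
  where "is_basis b \<longleftrightarrow> inj b \<and> independent (range b) \<and> span (range b) = UNIV"

definition map_matrix :: "(3 \<Rightarrow> 'v) \<Rightarrow> ('v \<Rightarrow> 'v) \<Rightarrow> complex ^ 3 ^ 3"
  where "map_matrix b h = (\<chi> i j. representation (range b) (h (b j)) (b i))"

text \<open>
  Trace and determinant are read off from the matrix in an arbitrarily chosen basis; for
  \<open>h \<in> Lin\<close> the choice is irrelevant, see \<open>map_trace_eq\<close> and \<open>map_det_eq\<close> below.
\<close>

definition map_trace :: "('v \<Rightarrow> 'v) \<Rightarrow> complex"
  where "map_trace h = trace (map_matrix (SOME b. is_basis b) h)"

definition map_det :: "('v \<Rightarrow> 'v) \<Rightarrow> complex"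
  where "map_det h = det (map_matrix (SOME b. is_basis b) h)"

definition proj_points :: "'v set set"
  where "proj_points = {span {v} | v. v \<noteq> 0}"

end

locale hermitian_space_21 = complex_space_3 scale
  for scale :: "complex \<Rightarrow> 'v::ab_group_add \<Rightarrow> 'v" +
  fixes herm :: "'v \<Rightarrow> 'v \<Rightarrow> complex"
  assumes herm_add_left: "herm (x + y) z = herm x z + herm y z"
    and herm_scale_left: "herm (scale c x) z = c * herm x z"
    and herm_commute: "herm y x = cnj (herm x y)"
    and signature: "\<exists>b :: 3 \<Rightarrow> 'v. is_basis b \<and>
          (\<forall>i j. herm (b i) (b j) = (if i \<noteq> j then 0 else if i = 3 then - 1 else 1))"
begin

definition negative_points :: "'v set set"
  where "negative_points = {p \<in> proj_points. \<forall>v\<in>p. v \<noteq> 0 \<longrightarrow> Re (herm v v) < 0}"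

text \<open>The adjoint exists and is unique for \<open>h \<in> Lin\<close>, see \<open>ex1_herm_adjoint\<close> below.\<close>

definition herm_adjoint :: "('v \<Rightarrow> 'v) \<Rightarrow> 'v \<Rightarrow> 'v"
  where "herm_adjoint h = (THE g. g \<in> Lin \<and> (\<forall>x y. herm (h x) y = herm x (g y)))"

definition base :: "('v \<Rightarrow> 'v) set \<Rightarrow> 'v set set"
  where "base W = {p \<in> proj_points. \<forall>h\<in>W. \<forall>v\<in>p. herm (h v) v = 0}"

definition degenerate_part :: "('v \<Rightarrow> 'v) set \<Rightarrow> ('v \<Rightarrow> 'v) set"
  where "degenerate_part W = {h \<in> W. map_det h = 0}"

definition bisector_family :: "('v \<Rightarrow> 'v) set \<Rightarrow> bool"
  where "bisector_family W \<longleftrightarrow>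
    W \<subseteq> Lin \<and> module.subspace (map_scaleR scale) W \<and>
    (\<forall>h\<in>W. map_trace h = 0 \<and> herm_adjoint h = h) \<and>
    W = module.span (map_scaleR scale) (degenerate_part W) \<and>
    base W \<inter> negative_points \<noteq> {}"

definition linear_family :: "('v \<Rightarrow> 'v) set \<Rightarrow> bool"
  where "linear_family W \<longleftrightarrow> bisector_family W \<and> degenerate_part W = W"

definition confocal_family :: "('v \<Rightarrow> 'v) set \<Rightarrow> 'v set \<Rightarrow> bool"
  where "confocal_family W f \<longleftrightarrow>
    linear_family W \<and> f \<in> proj_points \<and> (\<forall>h\<in>W. \<forall>v\<in>f. h v = 0)"

definition family_dim :: "('v \<Rightarrow> 'v) set \<Rightarrow> nat"
  where "family_dim W = vector_space.dim (map_scaleR scale) W"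

end

text \<open>
  \<open>module.subspace\<close>, \<open>module.span\<close> and \<open>vector_space.dim\<close> above refer to the following real
  vector space of maps.
\<close>

sublocale complex_space_3 \<subseteq> map_space: vector_space "map_scaleR scale"
  by unfold_locales
    (auto simp: map_scaleR_def plus_fun_def fun_eq_iff scale_right_distrib scale_left_distrib)

context complex_space_3
begin

lemma is_basisD:
  assumes "is_basis b"
  shows "inj b" "independent (range b)" "span (range b) = UNIV"
  using assms by (auto simp: is_basis_def)

lemma ex_is_basis: "\<exists>b. is_basis b"
proof -
  obtain B where B: "independent B" "span B = UNIV" "card B = 3"
    using basis_exists[of UNIV] dim_UNIV by (metis UNIV_I subsetI top.extremum_uniqueI)
  then have fin: "finite B" using card.infinite by fastforce
  obtain b :: "3 \<Rightarrow> 'v" where "bij_betw b UNIV B"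
    using finite_same_card_bij[OF finite fin, of "UNIV :: 3 set"] B(3) by auto
  then show ?thesis
    using B unfolding is_basis_def bij_betw_def by auto
qed

lemma basis_expand:
  assumes "is_basis b"
  shows "(\<Sum>i\<in>UNIV. scale (representation (range b) v (b i)) (b i)) = v"
proof -
  have "(\<Sum>x\<in>range b. scale (representation (range b) v x) x) = v"
    using is_basisD[OF assms] by (intro sum_representation_eq) auto
  then show ?thesis
    using is_basisD(1)[OF assms] by (simp add: sum.reindex)
qed

lemma basis_coord:
  assumes "is_basis b"
  shows "representation (range b) (\<Sum>i\<in>UNIV. scale (c i) (b i)) (b k) = c k"
proof -
  note b = is_basisD[OF assms]
  have "representation (range b) (\<Sum>i\<in>UNIV. scale (c i) (b i)) (b k)
      = (\<Sum>i\<in>UNIV. c i * representation (range b) (b i) (b k))"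
    using b by (simp add: representation_sum representation_scale)
  also have "\<dots> = (\<Sum>i\<in>UNIV. if i = k then c i else 0)"
    using b by (intro sum.cong) (auto simp: representation_basis inj_eq)
  finally show ?thesis by simp
qed

lemma representation_linear:
  assumes b: "is_basis b" and h: "h \<in> Lin"
  shows "representation (range b) (h v) (b i) =
    (\<Sum>j\<in>UNIV. map_matrix b h $ i $ j * representation (range b) v (b j))"
proof -
  interpret h: Vector_Spaces.linear scale scale h using h by (simp add: Lin_def)
  have "representation (range b) (h v) (b i) = representation (range b)
      (\<Sum>j\<in>UNIV. scale (representation (range b) v (b j)) (h (b j))) (b i)"
    by (subst basis_expand[OF b, of v, symmetric]) (simp add: h.sum h.scale)
  also have "\<dots> = (\<Sum>j\<in>UNIV. map_matrix b h $ i $ j * representation (range b) v (b j))"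
    using is_basisD[OF b]
    by (simp add: representation_sum representation_scale map_matrix_def mult.commute)
  finally show ?thesis .
qed

lemma map_matrix_change:
  assumes b: "is_basis b" and c: "is_basis c" and h: "h \<in> Lin"
  obtains P Q where "P ** Q = mat 1" "map_matrix c h = P ** map_matrix b h ** Q"
proof
  define P :: "complex^3^3" where "P = (\<chi> i j. representation (range c) (b j) (c i))"
  define Q :: "complex^3^3" where "Q = (\<chi> i j. representation (range b) (c j) (b i))"
  have P: "representation (range c) v (c i) =
      (\<Sum>j\<in>UNIV. P $ i $ j * representation (range b) v (b j))" for v i
  proof -
    have "representation (range c) v (c i) = representation (range c)
        (\<Sum>j\<in>UNIV. scale (representation (range b) v (b j)) (b j)) (c i)"
      by (simp add: basis_expand[OF b])
    then show ?thesis
      using is_basisD[OF c]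
      by (simp add: representation_sum representation_scale P_def mult.commute)
  qed
  show "P ** Q = mat 1"
    using is_basisD[OF c]
    by (simp add: vec_eq_iff matrix_matrix_mult_def mat_def Q_def P[symmetric]
        representation_basis inj_eq)
  show "map_matrix c h = P ** map_matrix b h ** Q"
    unfolding matrix_mul_assoc[symmetric]
    by (simp add: vec_eq_iff matrix_matrix_mult_def Q_def P representation_linear[OF b h]
        map_matrix_def[of c])
qed

lemma map_trace_eq:
  assumes "is_basis b" "h \<in> Lin"
  shows "map_trace h = trace (map_matrix b h)"
proof -
  obtain P Q where *: "P ** Q = mat 1"
    "map_matrix (SOME b. is_basis b) h = P ** map_matrix b h ** Q"
    using map_matrix_change[OF assms(1) someI_ex[OF ex_is_basis] assms(2)] .
  have "Q ** P = mat 1" using *(1) matrix_left_right_inverse by blast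
  then show ?thesis
    unfolding map_trace_def *(2) by (subst trace_mul_sym) (simp add: matrix_mul_assoc)
qed

lemma map_det_eq:
  assumes "is_basis b" "h \<in> Lin"
  shows "map_det h = det (map_matrix b h)"
proof -
  obtain P Q where *: "P ** Q = mat 1"
    "map_matrix (SOME b. is_basis b) h = P ** map_matrix b h ** Q"
    using map_matrix_change[OF assms(1) someI_ex[OF ex_is_basis] assms(2)] .
  have "det P * det Q = 1" using *(1) by (metis det_I det_mul)
  then show ?thesis
    unfolding map_det_def *(2) by (simp add: det_mul ac_simps)
qed

end

context hermitian_space_21
begin

lemma herm_add_right: "herm z (x + y) = herm z x + herm z y"
  by (metis complex_cnj_add herm_add_left herm_commute)

lemma herm_scale_right: "herm z (scale c x) = cnj c * herm z x"
  by (metis complex_cnj_mult herm_commute herm_scale_left)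

lemma herm_0_left: "herm 0 z = 0"
  using herm_add_left[of 0 0 z] by simp

lemma herm_0_right: "herm z 0 = 0"
  using herm_add_right[of z 0 0] by simp

lemma herm_sum_left: "herm (\<Sum>i\<in>A. f i) z = (\<Sum>i\<in>A. herm (f i) z)"
  by (induction A rule: infinite_finite_induct) (auto simp: herm_0_left herm_add_left)

lemma herm_sum_right: "herm z (\<Sum>i\<in>A. f i) = (\<Sum>i\<in>A. herm z (f i))"
  by (induction A rule: infinite_finite_induct) (auto simp: herm_0_right herm_add_right)

lemma ex1_herm_adjoint:
  assumes "h \<in> Lin"
  shows "\<exists>!g. g \<in> Lin \<and> (\<forall>x y. herm (h x) y = herm x (g y))"
proof -
  interpret h: Vector_Spaces.linear scale scale h using assms by (simp add: Lin_def)
  obtain b :: "3 \<Rightarrow> 'v" where b: "is_basis b"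
    and hb: "\<And>i j. herm (b i) (b j) = (if i \<noteq> j then 0 else if i = 3 then - 1 else 1)"
    using signature by blast
  define s :: "3 \<Rightarrow> complex" where "s i = (if i = 3 then - 1 else 1)" for i
  have hb': "herm (b i) (b j) = (if j = i then s i else 0)" for i j
    by (simp add: hb s_def)
  have expand: "v = (\<Sum>i\<in>UNIV. scale (s i * herm v (b i)) (b i))" for v
  proof -
    define c where "c i = representation (range b) v (b i)" for i
    have v: "v = (\<Sum>i\<in>UNIV. scale (c i) (b i))" using basis_expand[OF b] by (simp add: c_def)
    have "herm v (b i) = c i * s i" for i
    proof -
      have "herm v (b i) = (\<Sum>j\<in>UNIV. if j = i then c j * s j else 0)"
        unfolding v herm_sum_left herm_scale_left hb' by (intro sum.cong) auto
      then show ?thesis by simp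
    qed
    then have "s i * herm v (b i) = c i" for i by (simp add: s_def)
    then show ?thesis using v by simp
  qed
  define g where "g y = (\<Sum>i\<in>UNIV. scale (s i * herm y (h (b i))) (b i))" for y
  have "g \<in> Lin"
    unfolding Lin_def mem_Collect_eq
  proof (intro Vector_Spaces.linear.intro module_hom.intro module_hom_axioms.intro)
    show "g (x + y) = g x + g y" for x y
      by (simp add: g_def herm_add_left ring_distribs scale_left_distrib sum.distrib)
    show "g (scale c x) = scale c (g x)" for c x
      by (simp add: g_def herm_scale_left scale_sum_right ac_simps)
  qed (unfold_locales)
  moreover have "herm (h x) y = herm x (g y)" for x y
  proof -
    have "herm (h x) y = herm (h (\<Sum>i\<in>UNIV. scale (s i * herm x (b i)) (b i))) y"
      by (simp only: expand[of x, symmetric])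
    also have "\<dots> = (\<Sum>i\<in>UNIV. s i * herm x (b i) * herm (h (b i)) y)"
      by (simp add: h.sum h.scale herm_sum_left herm_scale_left)
    also have "\<dots> = herm x (g y)"
      unfolding g_def herm_sum_right herm_scale_right
      by (intro sum.cong) (auto simp: s_def herm_commute[of "h _" y])
    finally show ?thesis .
  qed
  moreover have "g' = g''"
    if "\<forall>x y. herm (h x) y = herm x (g' y)" "\<forall>x y. herm (h x) y = herm x (g'' y)" for g' g''
  proof
    fix y
    have "herm x (g' y) = herm x (g'' y)" for x using that by metis
    then have "herm (g' y) x = herm (g'' y) x" for x by (metis herm_commute)
    then show "g' y = g'' y" by (subst (1 2) expand) simp
  qed
  ultimately show ?thesis by blast
qed

lemma herm_adjoint:
  assumes "h \<in> Lin"
  shows "herm_adjoint h \<in> Lin" "herm (h x) y = herm x (herm_adjoint h y)"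
  unfolding herm_adjoint_def using theI'[OF ex1_herm_adjoint[OF assms]] by blast+

lemma herm_adjoint_unique:
  assumes "h \<in> Lin" "g \<in> Lin" "\<And>x y. herm (h x) y = herm x (g y)"
  shows "herm_adjoint h = g"
  unfolding herm_adjoint_def
  by (rule the1_equality[OF ex1_herm_adjoint[OF assms(1)]]) (intro conjI allI assms(2,3))

end

end

theory Submission
  imports Defs
begin

text \<open>
  Take a negative base point \<open>p\<close> of norm \<open>- 1\<close> and complete it to an orthonormal basis \<open>e1\<close>, \<open>e2\<close>,
  \<open>e3 = p\<close>. Selfadjoint traceless maps \<open>h\<close> with \<open>\<langle>h p, p\<rangle> = 0\<close> become the \<open>7\<close>-dimensional real
  space of hermitian matrices with rows \<open>(a, b, c)\<close>, \<open>(cnj b, - a, d)\<close>, \<open>(cnj c, cnj d, 0)\<close>, and \<open>W\<close>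
  becomes a subspace on which the determinant vanishes.

  If \<open>c = d = 0\<close> on \<open>W\<close>, then \<open>p\<close> is a common focus and \<open>W\<close> is a subspace of \<open>\<real>\<^sup>3\<close>, proper by
  assumption. The base is the preimage of the orthogonal complement under the Hopf map, so it
  determines \<open>W\<close>.

  Otherwise choose \<open>e1\<close> along some \<open>h p \<noteq> 0\<close>. Polarizing the determinant then leaves two cases. Either
  all forms vanish on one complex plane \<open>l = 0\<close>, hence are \<open>2 Re (cnj l \<sqdot> m)\<close> with \<open>m\<close> in a real
  subspace \<open>M\<close> of the dual space, and the base determines \<open>M\<close> by real duality; or \<open>W\<close> consists of all
  forms vanishing on a real plane.
\<close>

section \<open>Traceless hermitian forms in coordinates, and real duality\<close>

type_synonym form = "real \<times> complex \<times> complex \<times> complex"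
type_synonym coords = "complex \<times> complex \<times> complex"

text \<open>
  A \<open>form\<close> \<open>(a, b, c, d)\<close> stands for the hermitian matrix above; \<open>sesq\<close> is its sesquilinear form,
  linear in the first argument, \<open>quad\<close> its quadratic form and \<open>disc\<close> its determinant.
\<close>

fun sesq :: "form \<Rightarrow> coords \<Rightarrow> coords \<Rightarrow> complex" where
  "sesq (a, b, c, d) (x, y, z) (x', y', z') =
     of_real a * (x * cnj x' - y * cnj y') +
     b * cnj x' * y + c * cnj x' * z + d * cnj y' * z +
     cnj b * x * cnj y' + cnj c * x * cnj z' + cnj d * y * cnj z'"

fun quad :: "form \<Rightarrow> coords \<Rightarrow> real" where
  "quad (a, b, c, d) (x, y, z) = a * ((cmod x)\<^sup>2 - (cmod y)\<^sup>2) +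
     2 * Re (b * cnj x * y + c * cnj x * z + d * cnj y * z)"

fun disc :: "form \<Rightarrow> real" where
  "disc (a, b, c, d) = a * ((cmod c)\<^sup>2 - (cmod d)\<^sup>2) + 2 * Re (b * cnj c * d)"

fun dot :: "coords \<Rightarrow> coords \<Rightarrow> complex" where
  "dot (l, m, n) (x, y, z) = l * x + m * y + n * z"

lemma quad_add: "quad (g + h) v = quad g v + quad h v"
  by (cases g; cases h; cases v) (simp add: algebra_simps)

lemma quad_scaleR: "quad (r *\<^sub>R h) v = r * quad h v"
  by (cases h; cases v) (simp add: algebra_simps)

lemma dot_add: "dot (l + m) v = dot l v + dot m v" "dot l (v + w) = dot l v + dot l w"
  by (cases l; cases m; cases v, simp add: algebra_simps) (cases l; cases w; cases v, simp add: algebra_simps)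

lemma dot_scaleR: "dot (r *\<^sub>R l) v = of_real r * dot l v" "dot l (r *\<^sub>R v) = of_real r * dot l v"
  by (cases l; cases v, simp add: algebra_simps scaleR_conv_of_real)+

text \<open>The component of \<open>x\<close> orthogonal to \<open>S\<close> serves as
  \<open>z\<close>. This is the real duality used both for functionals in the plane case and for
  forms in the focus case.\<close>

lemma orthogonal_separation:
  fixes S :: "'a::euclidean_space set"
  assumes "subspace S" "x \<notin> S"
  obtains z where "\<And>y. y \<in> S \<Longrightarrow> y \<bullet> z = 0" "x \<bullet> z \<noteq> 0"
proof -
  obtain y z where yz: "y \<in> span S" "\<And>w. w \<in> span S \<Longrightarrow> orthogonal z w" "x = y + z"
    using orthogonal_subspace_decomp_exists[of S x] by metis
  have "span S = S" using assms(1) by (simp add: span_eq_iff)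
  then have "y \<in> S" using yz(1) by (metis (no_types))
  then have "z \<noteq> 0" using yz(3) assms(2) by auto
  show ?thesis
  proof
    show "w \<bullet> z = 0" if "w \<in> S" for w
      using yz(2)[of w] that by (auto simp: orthogonal_def span_base inner_commute)
    show "x \<bullet> z \<noteq> 0" using yz(1,3) yz(2)[of y] \<open>z \<noteq> 0\<close>
      by (simp add: orthogonal_def inner_add_left inner_commute[of y])
  qed
qed

text \<open>At \<open>(1, 1, 0)\<close> and \<open>(1, \<i>, 0)\<close> the term in \<open>a\<close>
  cancels; the other vectors read off \<open>a\<close> and then the real and imaginary parts of
  \<open>c\<close> and \<open>d\<close>.\<close>

lemma quad_eq_0_imp:
  assumes "\<And>v. quad h v = 0"
  shows "h = 0"
proof -
  obtain a b c d where h: "h = (a, b, c, d)" by (cases h)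
  have "a = 0" using assms[of "(1, 0, 0)"] by (simp add: h)
  moreover have "Re b = 0" "Im b = 0" 
    using assms[of "(1, 1, 0)"] assms[of "(1, \<i>, 0)"] by (simp_all add: h)
  moreover have "Re c = 0" "Im c = 0" 
    using assms[of "(1, 0, 1)"] assms[of "(1, 0, \<i>)"] \<open>a = 0\<close> by (simp_all add: h)
  moreover have "Re d = 0" "Im d = 0" 
    using assms[of "(0, 1, 1)"] assms[of "(0, 1, \<i>)"] \<open>a = 0\<close> by (simp_all add: h)
  ultimately show ?thesis by (simp add: h complex_eq_iff zero_prod_def)
qed

section \<open>Forms vanishing on a complex plane\<close>

text \<open>Choose \<open>e\<close> with \<open>dot l e = 1\<close> and write
  \<open>v = t e + w\<close> with \<open>t = dot l v\<close>. Then \<open>w\<close> lies in the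
  plane and contributes nothing by itself, so every remaining term of the expansion has a factor
  \<open>t\<close> or \<open>cnj t\<close>.\<close>

lemma quad_factor:
  assumes l: "l \<noteq> 0" and van: "\<And>v. dot l v = 0 \<Longrightarrow> quad h v = 0"
  obtains m where "\<And>v. quad h v = 2 * Re (cnj (dot l v) * dot m v)"
proof -
  obtain a b c d where h: "h = (a, b, c, d)" by (cases h)
  obtain l1 l2 l3 where l': "l = (l1, l2, l3)" by (cases l)
  have nz: "l1 * cnj l1 + l2 * cnj l2 + l3 * cnj l3 \<noteq> 0" (is "?N \<noteq> 0")
  proof -
    have "?N = of_real ((cmod l1)\<^sup>2 + (cmod l2)\<^sup>2 + (cmod l3)\<^sup>2)"
      by (simp only: of_real_add complex_norm_square)
    moreover have "(cmod l1)\<^sup>2 + (cmod l2)\<^sup>2 + (cmod l3)\<^sup>2 \<noteq> 0"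
      using l by (auto simp: l' zero_prod_def add_nonneg_eq_0_iff)
    ultimately show ?thesis by (metis of_real_eq_0_iff)
  qed
  \<comment> \<open>\<open>(p, q, r)\<close> is the vector \<open>e\<close>: the conjugate of
    \<open>l\<close>, divided by the squared length of \<open>l\<close>.\<close>
  define p q r where "p = cnj l1 / ?N" and "q = cnj l2 / ?N" and "r = cnj l3 / ?N"
  have e: "dot l (p, q, r) = 1"
    using nz by (simp add: l' p_def q_def r_def add_divide_distrib[symmetric])
  \<comment> \<open>\<open>m\<close> is the functional sending \<open>v\<close> to
    \<open>sesq h v e - k * dot l v\<close>. The two cross terms count
    \<open>(cmod t)^2 * quad h e\<close> twice; subtracting half of it from each corrects
    this.\<close>
  define k where "k = complex_of_real (quad h (p, q, r)) / 2"
  define m where "m = (of_real a * cnj p + cnj b * cnj q + cnj c * cnj r - k * l1,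
     - of_real a * cnj q + b * cnj p + cnj d * cnj r - k * l2, c * cnj p + d * cnj q - k * l3)"
  have "quad h v = 2 * Re (cnj (dot l v) * dot m v)" for v
  proof -
    obtain x y z where v: "v = (x, y, z)" by (cases v)
    define t where "t = dot l v"
    define w where "w = (x - t * p, y - t * q, z - t * r)"
    have "dot l w = dot l v - t * dot l (p, q, r)"
      by (simp add: w_def l' v algebra_simps)
    then have w0: "quad h w = 0" using e van by (simp add: t_def)
    have dm: "dot m v = sesq h v (p, q, r) - k * t"
      by (simp add: m_def t_def h l' v algebra_simps)
    have Q: "complex_of_real (quad h u) = sesq h u u" for u
      by (cases u) (simp add: h complex_eq_iff cmod_power2, simp add: power2_eq_square algebra_simps)
    have "sesq h v v = sesq h w w + cnj t * sesq h v (p, q, r) + t * sesq h (p, q, r) v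
        - t * cnj t * sesq h (p, q, r) (p, q, r)"
      by (simp add: w_def v h algebra_simps)
    moreover have "sesq h (p, q, r) v = cnj (sesq h v (p, q, r))"
      by (simp add: v h algebra_simps)
    ultimately have "complex_of_real (quad h v) = cnj t * sesq h v (p, q, r)
       + cnj (cnj t * sesq h v (p, q, r)) - t * cnj t * 2 * k"
      by (simp add: Q[symmetric] w0 k_def)
    then have "quad h v = Re (cnj t * sesq h v (p, q, r)
       + cnj (cnj t * sesq h v (p, q, r)) - t * cnj t * 2 * k)" by (metis Re_complex_of_real)
    also have "\<dots> = 2 * Re (cnj t * (sesq h v (p, q, r) - k * t))"
      by (simp add: algebra_simps)
    finally show ?thesis by (simp add: dm t_def)
  qed
  then show ?thesis using that by blast
qed

text \<open>All forms of \<open>W\<close>, and \<open>h0\<close> too, factor as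
  \<open>2 Re (cnj l * m)\<close>. If \<open>w\<close> is annihilated by the real parts of all
  \<open>m\<close> in \<open>M\<close>, then \<open>dot l w\<close> is real, so \<open>w\<close> is
  a common zero of \<open>W\<close>, and \<open>quad h0 w\<close> is
  \<open>2 * dot l w * Re (dot m0 w)\<close>. If \<open>m0\<close> were outside \<open>M\<close>,
  some such \<open>w\<close> would make this nonzero.\<close>

lemma isotropic_plane_case:
  assumes W: "subspace W" and l: "l \<noteq> 0"
    and van: "\<And>h v. h \<in> W \<Longrightarrow> dot l v = 0 \<Longrightarrow> quad h v = 0"
    and h0: "\<And>v. (\<And>h. h \<in> W \<Longrightarrow> quad h v = 0) \<Longrightarrow> quad h0 v = 0"
  shows "h0 \<in> W"
proof -
  define M where "M = {m. \<exists>h\<in>W. \<forall>v. quad h v = 2 * Re (cnj (dot l v) * dot m v)}"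
  have M: "subspace M"
  proof (rule subspaceI)
    show "0 \<in> M" unfolding M_def
      using subspace_0[OF W] by (auto intro!: bexI[of _ 0] simp: zero_prod_def)
    show "m + n \<in> M" if "m \<in> M" "n \<in> M" for m n
    proof -
      obtain g h where "g \<in> W" "\<forall>v. quad g v = 2 * Re (cnj (dot l v) * dot m v)"
        "h \<in> W" "\<forall>v. quad h v = 2 * Re (cnj (dot l v) * dot n v)"
        using \<open>m \<in> M\<close> \<open>n \<in> M\<close> unfolding M_def by blast
      then show ?thesis unfolding M_def
        by (auto intro!: bexI[of _ "g + h"] simp: subspace_add[OF W] quad_add dot_add algebra_simps)
    qed
    show "r *\<^sub>R m \<in> M" if "m \<in> M" for r m
    proof -
      obtain g where "g \<in> W" "\<forall>v. quad g v = 2 * Re (cnj (dot l v) * dot m v)"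
        using \<open>m \<in> M\<close> unfolding M_def by blast
      then show ?thesis unfolding M_def
        by (auto intro!: bexI[of _ "r *\<^sub>R g"] simp: subspace_scale[OF W] quad_scaleR dot_scaleR algebra_simps)
    qed
  qed
  obtain l1 l2 l3 where l': "l = (l1, l2, l3)" by (cases l)
  \<comment> \<open>\<open>\<i> l\<close> gives the zero form, so points orthogonal to \<open>M\<close> have real \<open>l\<close>-coordinate; \<open>l\<close> gives
    \<open>2 |l|\<^sup>2\<close>, which is not a \<open>form\<close>, so \<open>l\<close> is nonzero at some of these points.\<close>
  have il: "(\<i> * l1, \<i> * l2, \<i> * l3) \<in> M" 
  proof -
    have "dot (\<i> * l1, \<i> * l2, \<i> * l3) v = \<i> * dot l v" for v
      by (cases v) (simp add: l' algebra_simps)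
    moreover have "Re (cnj t * (\<i> * t)) = 0" for t by simp
    moreover have "quad 0 v = 0" for v by (cases v) (simp add: zero_prod_def)
    ultimately show ?thesis unfolding M_def 
      using subspace_0[OF W] by (auto intro!: bexI[of _ 0] simp del: dot.simps split_paired_All)
  qed
  have lM: "l \<notin> M"
  proof
    assume "l \<in> M"
    then obtain h where h: "\<And>v. quad h v = 2 * Re (cnj (dot l v) * dot l v)"
      unfolding M_def by blast
    obtain a b c d where habcd: "h = (a, b, c, d)" by (cases h)
    have *: "Re (cnj t * t) = (cmod t)\<^sup>2" for t
      by (simp add: cmod_power2 flip: power2_eq_square)
    have "l3 = 0" using h[of "(0, 0, 1)"] unfolding * by (simp add: habcd l')
    \<comment> \<open>The shape of a \<open>form\<close> enters here: its diagonal entries are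
      \<open>a\<close>, \<open>- a\<close> and \<open>0\<close>, whereas a nonnegative form with
      zero trace has to vanish.\<close>
    have "quad h (1, 0, 0) + quad h (0, 1, 0) = 0" by (simp add: habcd)
    then have "2 * (cmod l1)\<^sup>2 + 2 * (cmod l2)\<^sup>2 = 0" 
      unfolding h * by (simp add: l')
    then have "l1 = 0" "l2 = 0" by (auto simp: add_nonneg_eq_0_iff)
    then show False using l \<open>l3 = 0\<close> by (simp add: l' zero_prod_def)
  qed
  have separate: "\<exists>y. (\<forall>m\<in>M. Re (dot m y) = 0) \<and> Re (dot n y) \<noteq> 0" if "n \<notin> M" for n
  proof -
    obtain z where z: "\<And>y. y \<in> M \<Longrightarrow> y \<bullet> z = 0" "n \<bullet> z \<noteq> 0"
      using orthogonal_separation[OF M \<open>n \<notin> M\<close>] by blast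
    obtain z1 z2 z3 where z': "z = (z1, z2, z3)" by (cases z)
    \<comment> \<open>The real inner product is \<open>Re (m * cnj z)\<close> in each coordinate, so
      conjugating \<open>z\<close> turns it into the real part of \<open>dot\<close>.\<close>
    have "Re (dot m (cnj z1, cnj z2, cnj z3)) = m \<bullet> z" for m
      by (cases m) (simp add: z' inner_complex_def)
    then show ?thesis using z by metis
  qed
  have "\<And>v. dot l v = 0 \<Longrightarrow> quad h0 v = 0" using h0 van by blast
  then obtain m0 where m0: "\<And>v. quad h0 v = 2 * Re (cnj (dot l v) * dot m0 v)"
    using quad_factor[OF l] by blast
  have "m0 \<in> M"
  proof (rule ccontr)
    assume "m0 \<notin> M"
    then obtain y where y: "\<And>m. m\<in>M \<Longrightarrow> Re (dot m y) = 0" "Re (dot m0 y) \<noteq> 0" using separate by blast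
    obtain y' where y': "\<And>m. m\<in>M \<Longrightarrow> Re (dot m y') = 0" "Re (dot l y') \<noteq> 0" using separate lM by blast
    \<comment> \<open>One of \<open>y\<close>, \<open>y'\<close> serves both \<open>m0\<close> and
      \<open>l\<close> unless \<open>Re (dot l y)\<close> and \<open>Re (dot m0 y')\<close> both
      vanish, and then \<open>y + y'\<close> does.\<close>
    have "\<exists>w. (\<forall>m\<in>M. Re (dot m w) = 0) \<and> Re (dot m0 w) \<noteq> 0 \<and> Re (dot l w) \<noteq> 0"
    proof (cases "Re (dot l y) = 0 \<and> Re (dot m0 y') = 0")
      case True then show ?thesis using y y' by (intro exI[of _ "y + y'"]) (simp add: dot_add)
    next
      case False then show ?thesis using y y' by blast
    qed
    then obtain w where w: "\<And>m. m\<in>M \<Longrightarrow> Re (dot m w) = 0" "Re (dot m0 w) \<noteq> 0" "Re (dot l w) \<noteq> 0" 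
      by blast
    have "dot (\<i> * l1, \<i> * l2, \<i> * l3) w = \<i> * dot l w"
      by (cases w) (simp add: l' algebra_simps)
    then have im: "Im (dot l w) = 0" using w(1)[OF il] by simp
    have "quad h w = 0" if h: "h \<in> W" for h
    proof -
      obtain m where m: "\<And>v. quad h v = 2 * Re (cnj (dot l v) * dot m v)"
        using quad_factor[OF l van[OF h]] by blast
      then have "m \<in> M" using h unfolding M_def by blast
      then show ?thesis using w(1) by (simp add: m im)
    qed
    then have "quad h0 w = 0" using h0 by blast
    then show False using w by (simp add: m0 im)
  qed
  then obtain k where k: "k \<in> W" "\<And>v. quad k v = quad h0 v"
    unfolding M_def mem_Collect_eq m0[symmetric] by blast
  have "h0 - k = 0" 
    using quad_add[of h0 "(-1) *\<^sub>R k"] quad_scaleR[of "-1" k]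
    by (intro quad_eq_0_imp) (simp add: k)
  then show ?thesis using k by simp
qed

section \<open>Negative common focus and the Hopf map\<close>

text \<open>The solution is sought with \<open>(cmod x)^2 + (cmod y)^2 = N\<close>, which forces
  \<open>(cmod x)^2 = (N + \<alpha>) / 2\<close>. Taking \<open>x\<close> real determines
  \<open>y\<close> from \<open>\<gamma>\<close>, except when \<open>x = 0\<close>, where
  \<open>\<gamma> = 0\<close> as well.\<close>

lemma hopf_surjective:
  obtains x y :: complex where "(cmod x)\<^sup>2 - (cmod y)\<^sup>2 = \<alpha>" "2 * cnj x * y = \<gamma>"
proof -
  define N where "N = sqrt (\<alpha>\<^sup>2 + (cmod \<gamma>)\<^sup>2)"
  have N2: "N\<^sup>2 = \<alpha>\<^sup>2 + (cmod \<gamma>)\<^sup>2" by (simp add: N_def)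
  have "\<bar>\<alpha>\<bar> \<le> N" unfolding N_def by (rule real_le_rsqrt) simp
  show ?thesis
  proof (cases "N + \<alpha> = 0")
    case True
    then have "\<gamma> = 0" using N2 by (simp add: add_eq_0_iff)
    moreover have "(cmod (complex_of_real (sqrt (- \<alpha>))))\<^sup>2 = - \<alpha>"
      using True \<open>\<bar>\<alpha>\<bar> \<le> N\<close> by simp
    ultimately show ?thesis
      by (intro that[of 0 "complex_of_real (sqrt (- \<alpha>))"]) (simp_all del: norm_of_real)
  next
    case False
    then have pos: "N + \<alpha> > 0" using \<open>\<bar>\<alpha>\<bar> \<le> N\<close> by linarith
    define r where "r = sqrt ((N + \<alpha>) / 2)"
    have r2: "r\<^sup>2 = (N + \<alpha>) / 2" "r \<noteq> 0" using pos by (auto simp: r_def)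
    have "(cmod \<gamma>)\<^sup>2 = (N + \<alpha>) * (N - \<alpha>)" using N2 by (simp add: power2_eq_square algebra_simps)
    then have "(cmod (\<gamma> / (2 * of_real r)))\<^sup>2 = (N - \<alpha>) / 2"
      using pos by (simp add: norm_divide norm_mult power_divide power_mult_distrib r2(1) field_simps)
    then show ?thesis using r2
      by (intro that[of "of_real r" "\<gamma> / (2 * of_real r)"]) (simp_all add: field_simps)
  qed
qed

text \<open>Forms with \<open>c = d = 0\<close> are real linear functionals of the Hopf image of
  \<open>(x, y)\<close> and do not see \<open>z\<close>. Every vector orthogonal to \<open>W\<close>
  therefore lifts to common zeros with \<open>z\<close> free. A nonzero lift forces
  \<open>c = d = 0\<close> in \<open>h0\<close>, and orthogonality then puts \<open>h0\<close> into
  \<open>W\<close>.\<close>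

lemma negative_focus_case:
  assumes W: "subspace W" and foc: "\<And>a b c d. (a, b, c, d) \<in> W \<Longrightarrow> c = 0 \<and> d = 0"
    and g: "(a1, b1, 0, 0) \<notin> W"
    and h0: "\<And>v. (\<And>h. h \<in> W \<Longrightarrow> quad h v = 0) \<Longrightarrow> quad h0 v = 0"
  shows "h0 \<in> W"
proof -
  obtain a b c d where h0': "h0 = (a, b, c, d)" by (cases h0)
  have key: "a * \<alpha> + Re (b * cnj \<gamma>) = 0 \<and> (\<alpha> \<noteq> 0 \<or> \<gamma> \<noteq> 0 \<longrightarrow> c = 0 \<and> d = 0)"
    if orth: "\<And>a b. (a, b, 0, 0) \<in> W \<Longrightarrow> a * \<alpha> + Re (b * cnj \<gamma>) = 0" for \<alpha> \<gamma>
  proof -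
    obtain x y where xy: "(cmod x)\<^sup>2 - (cmod y)\<^sup>2 = \<alpha>" "2 * cnj x * y = cnj \<gamma>"
      using hopf_surjective by metis
    \<comment> \<open>\<open>(- cnj y, cnj x)\<close> has the antipodal Hopf image, so it lies over
      a zero of the same functionals. It supplies a second equation for \<open>c\<close> and
      \<open>d\<close>.\<close>
    have base: "quad h0 (x, y, z) = 0 \<and> quad h0 (- cnj y, cnj x, z) = 0" for z
    proof -
      have "quad h (x, y, z) = 0 \<and> quad h (- cnj y, cnj x, z) = 0" if "h \<in> W" for h
      proof -
        obtain a b c d where h: "h = (a, b, c, d)" by (cases h)
        have cd: "c = 0" "d = 0" using foc that h by auto
        have "2 * Re (b * cnj x * y) = Re (b * cnj \<gamma>)"
          unfolding xy(2)[symmetric] by (simp add: algebra_simps)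
        moreover have "2 * Re (b * y * cnj x) = Re (b * cnj \<gamma>)"
          unfolding xy(2)[symmetric] by (simp add: algebra_simps)
        ultimately show ?thesis
          using orth[of a b] that xy(1) by (simp add: h cd algebra_simps)
      qed
      then show ?thesis using h0 by blast
    qed
    have "a * \<alpha> + Re (b * cnj \<gamma>) = 0"
    proof -
      have "2 * Re (b * cnj x * y) = Re (b * cnj \<gamma>)"
        unfolding xy(2)[symmetric] by (simp add: algebra_simps)
      then show ?thesis using base[of 0] xy(1) by (simp add: h0')
    qed
    moreover have "c = 0 \<and> d = 0" if "\<alpha> \<noteq> 0 \<or> \<gamma> \<noteq> 0"
    proof -
      \<comment> \<open>The values \<open>z = 1\<close> and \<open>z = \<i>\<close>, compared with
        \<open>z = 0\<close>, isolate the real and imaginary parts of the coefficient of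
        \<open>z\<close>.\<close>
      have 1: "c * cnj x + d * cnj y = 0"
        using base[of 0] base[of 1] base[of \<i>] by (simp add: h0' complex_eq_iff)
      have 2: "d * x - c * y = 0"
        using base[of 0] base[of 1] base[of \<i>] by (simp add: h0' complex_eq_iff)
      have "x \<noteq> 0 \<or> y \<noteq> 0" using that xy by auto
      then have "(cmod x)\<^sup>2 + (cmod y)\<^sup>2 \<noteq> 0" by (auto simp: add_nonneg_eq_0_iff)
      then have nz: "x * cnj x + y * cnj y \<noteq> 0"
        unfolding complex_norm_square[symmetric] by (metis of_real_add of_real_eq_0_iff)
      \<comment> \<open>Cramer's rule for the two equations, whose determinant is
        \<open>x * cnj x + y * cnj y\<close>.\<close>
      have "c * (x * cnj x + y * cnj y) = x * (c * cnj x + d * cnj y) - cnj y * (d * x - c * y)"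
        "d * (x * cnj x + y * cnj y) = y * (c * cnj x + d * cnj y) + cnj x * (d * x - c * y)"
        by (simp_all add: algebra_simps)
      then show ?thesis using nz unfolding 1 2 by simp
    qed
    ultimately show ?thesis by blast
  qed
  have cd: "c = 0 \<and> d = 0"
  proof -
    \<comment> \<open>The missing form \<open>(a1, b1, 0, 0)\<close> provides a vector orthogonal to
      \<open>W\<close> whose part \<open>(\<alpha>, \<gamma>)\<close> is nonzero.\<close>
    obtain z where z: "\<And>y. y \<in> W \<Longrightarrow> y \<bullet> z = 0" "(a1, b1, 0, 0) \<bullet> z \<noteq> 0"
      using orthogonal_separation[OF W g] by blast
    obtain \<alpha> \<gamma> z3 z4 where z': "z = (\<alpha>, \<gamma>, z3, z4)" by (cases z)
    have "\<alpha> \<noteq> 0 \<or> \<gamma> \<noteq> 0" using z(2) by (auto simp: z')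
    then show ?thesis using key[of \<alpha> \<gamma>] z(1) by (force simp: z' inner_complex_def)
  qed
  show ?thesis
  proof (rule ccontr)
    assume "h0 \<notin> W"
    then obtain z where z: "\<And>y. y \<in> W \<Longrightarrow> y \<bullet> z = 0" "h0 \<bullet> z \<noteq> 0"
      using orthogonal_separation[OF W] by blast
    obtain \<alpha> \<gamma> z3 z4 where z': "z = (\<alpha>, \<gamma>, z3, z4)" by (cases z)
    have "a * \<alpha> + Re (b * cnj \<gamma>) = 0" using key[of \<alpha> \<gamma>] z(1) by (force simp: z' inner_complex_def)
    then show False using z(2) cd by (simp add: z' h0' inner_complex_def)
  qed
qed

section \<open>Real planes and polarization of the determinant\<close>

text \<open>All forms of \<open>W\<close> vanish on the real span of \<open>(\<i>, 0, 0)\<close>,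
  \<open>(0, cnj \<beta>, 0)\<close>, \<open>(0, 0, 1)\<close>. Vanishing of \<open>h0\<close> there
  gives \<open>a = 0\<close> and one real condition on each of \<open>b\<close>, \<open>c\<close>,
  \<open>d\<close>, which leaves exactly the span of the three generators.\<close>

lemma real_plane_case:
  assumes W: "subspace W" and "\<beta> \<noteq> 0"
    and gens: "(0, \<beta>, 0, 0) \<in> W" "(0, 0, 1, 0) \<in> W" "(0, 0, 0, \<i> * cnj \<beta>) \<in> W"
    and sub: "\<And>h. h \<in> W \<Longrightarrow> \<exists>r c t. h = (0, of_real r * \<beta>, of_real c, of_real t * (\<i> * cnj \<beta>))"
    and h0: "\<And>v. (\<And>h. h \<in> W \<Longrightarrow> quad h v = 0) \<Longrightarrow> quad h0 v = 0"
  shows "h0 \<in> W"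
proof -
  obtain a b c d where h0': "h0 = (a, b, c, d)" by (cases h0)
  have base: "quad h0 (\<i> * of_real X, cnj \<beta> * of_real Y, of_real Z) = 0" for X Y Z
    using sub by (intro h0) (fastforce simp: algebra_simps)
  have "a = 0" using base[of 1 0 0] by (simp add: h0')
  moreover have "Im (b * cnj \<beta>) = 0" using base[of 1 1 0] \<open>a = 0\<close> by (simp add: h0' algebra_simps)
  moreover have "Im c = 0" using base[of 1 0 1] \<open>a = 0\<close> by (simp add: h0')
  moreover have "Re (d * \<beta>) = 0" using base[of 0 1 1] \<open>a = 0\<close> by (simp add: h0' algebra_simps)
  moreover have "b = of_real (Re (b * cnj \<beta>) / (cmod \<beta>)\<^sup>2) * \<beta>"
  proof -
    have "b * cnj \<beta> = of_real (Re (b * cnj \<beta>))" using \<open>Im (b * cnj \<beta>) = 0\<close> by (simp add: complex_eq_iff)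
    then have "b * (\<beta> * cnj \<beta>) = of_real (Re (b * cnj \<beta>)) * \<beta>" by (metis mult.assoc mult.commute)
    then show ?thesis using \<open>\<beta> \<noteq> 0\<close>
      by (simp add: complex_norm_square[symmetric] field_simps del: of_real_power)
  qed
  moreover have "d = of_real (Im (d * \<beta>) / (cmod \<beta>)\<^sup>2) * (\<i> * cnj \<beta>)"
  proof -
    have "d * \<beta> = \<i> * of_real (Im (d * \<beta>))" using \<open>Re (d * \<beta>) = 0\<close> by (simp add: complex_eq_iff)
    then have "d * (\<beta> * cnj \<beta>) = of_real (Im (d * \<beta>)) * (\<i> * cnj \<beta>)" by (metis mult.assoc mult.commute)
    then show ?thesis using \<open>\<beta> \<noteq> 0\<close>
      by (simp add: complex_norm_square[symmetric] field_simps del: of_real_power)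
  qed
  ultimately obtain r t where bd: "b = of_real r * \<beta>" "d = of_real t * (\<i> * cnj \<beta>)" by blast
  have "h0 = r *\<^sub>R (0, \<beta>, 0, 0) + Re c *\<^sub>R (0, 0, 1, 0) + t *\<^sub>R (0, 0, 0, \<i> * cnj \<beta>)"
    using \<open>a = 0\<close> \<open>Im c = 0\<close> by (simp add: h0' bd complex_eq_iff)
  then show ?thesis using gens by (simp only: subspace_add[OF W] subspace_scale[OF W])
qed

lemma imaginary_product_imp_multiple:
  assumes "d \<noteq> 0" "Re (d * w) = 0"
  shows "w = \<i> * of_real (Im (d * w) / (cmod d)\<^sup>2) * cnj d"
proof -
  have "d * w = \<i> * of_real (Im (d * w))" using assms(2) by (simp add: complex_eq_iff)
  then have "w * (d * cnj d) = \<i> * of_real (Im (d * w)) * cnj d" by (metis mult.assoc mult.commute)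
  then show ?thesis using \<open>d \<noteq> 0\<close>
    by (simp add: complex_norm_square[symmetric] field_simps del: of_real_power)
qed

text \<open>Polarizing along \<open>(0, b1, 1, 0)\<close> attaches a real slope \<open>s\<close> to
  each element with \<open>d \<noteq> 0\<close>. If all \<open>d\<close> vanish, or if one slope
  fits all of \<open>W\<close>, the forms vanish on a complex plane; otherwise \<open>W\<close> is
  the space belonging to a real plane.\<close>

lemma nonzero_column_case:
  assumes W: "subspace W" and sing: "\<And>h. h \<in> W \<Longrightarrow> disc h = 0" and h1: "(0, b1, 1, 0) \<in> W"
    and h0: "\<And>v. (\<And>h. h \<in> W \<Longrightarrow> quad h v = 0) \<Longrightarrow> quad h0 v = 0"
  shows "h0 \<in> W"
proof -
  have comb: "(r * a + t * a', of_real r * b + of_real t * b', of_real r * c + of_real t * c',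
      of_real r * d + of_real t * d') \<in> W" if "(a, b, c, d) \<in> W" "(a', b', c', d') \<in> W"
    for r t a b c d a' b' c' d'
    using subspace_add[OF W subspace_scale[OF W that(1), of r] subspace_scale[OF W that(2), of t]]
    by (simp add: scaleR_conv_of_real)
  \<comment> \<open>the coefficients of \<open>t\<^sup>2\<close> and \<open>t\<close> in \<open>disc (h + t (0, b1, 1, 0))\<close>\<close>
  have polar: "a + 2 * Re (b1 * d) = 0" "Re (d * (b - c * b1)) = 0"
    and disc0: "a * ((cmod c)\<^sup>2 - (cmod d)\<^sup>2) + 2 * Re (b * cnj c * d) = 0"
    if h: "(a, b, c, d) \<in> W" for a b c d
  proof -
    have 0: "disc (a, b, c, d) = 0" and 1: "disc (a, b + b1, c + 1, d) = 0"
      and 2: "disc (a, b - b1, c - 1, d) = 0"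
      using sing[OF h] sing[OF comb[OF h h1, of 1 1]] sing[OF comb[OF h h1, of 1 "-1"]] by simp_all
    show "a * ((cmod c)\<^sup>2 - (cmod d)\<^sup>2) + 2 * Re (b * cnj c * d) = 0" using 0 by simp
    have "disc (a, b + b1, c + 1, d) + disc (a, b - b1, c - 1, d) - 2 * disc (a, b, c, d)
      = 2 * (a + 2 * Re (b1 * d))"
      by (simp add: cmod_power2) (simp add: power2_eq_square algebra_simps)
    then show *: "a + 2 * Re (b1 * d) = 0" unfolding 0 1 2 by simp
    \<comment> \<open>The first difference sees only the linear coefficient, since the cubic one is
      \<open>disc (0, b1, 1, 0) = 0\<close>.\<close>
    have "disc (a, b + b1, c + 1, d) - disc (a, b - b1, c - 1, d)
      = 4 * Re (d * (b - c * b1)) + 4 * Re c * (a + 2 * Re (b1 * d))"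
      by (simp add: cmod_power2) (simp add: power2_eq_square algebra_simps)
    then show "Re (d * (b - c * b1)) = 0" unfolding * 1 2 by simp
  qed
  have slope: "\<exists>s. b - c * b1 = \<i> * of_real s * cnj d \<and> a = 2 * s * Im c"
    if h: "(a, b, c, d) \<in> W" and d: "d \<noteq> 0" for a b c d
  proof -
    define s where "s = Im (d * (b - c * b1)) / (cmod d)\<^sup>2"
    have s: "b - c * b1 = \<i> * of_real s * cnj d"
      unfolding s_def by (rule imaginary_product_imp_multiple[OF d polar(2)[OF h]])
    then have b: "b = c * b1 + \<i> * of_real s * cnj d" by (simp add: algebra_simps)
    \<comment> \<open>With \<open>b\<close> substituted, this combination is the determinant; its
      first summand vanishes by \<open>polar\<close>.\<close>
    have "(cmod c)\<^sup>2 * (a + 2 * Re (b1 * d)) - (cmod d)\<^sup>2 * (a - 2 * s * Im c) = 0"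
      using disc0[OF h] unfolding b cmod_power2 by (simp add: power2_eq_square algebra_simps)
    then show ?thesis using s d polar(1)[OF h] by auto
  qed
  show ?thesis
  proof (cases "\<forall>a b c d. (a, b, c, d) \<in> W \<longrightarrow> d = 0")
    case True
    \<comment> \<open>Here \<open>d = 0\<close> forces \<open>a = 0\<close>, so every form has the
      factor \<open>cnj x\<close> inside the real part and vanishes on \<open>x = 0\<close>.\<close>
    show ?thesis
    proof (rule isotropic_plane_case[OF W _ _ h0, where l = "(1, 0, 0)"])
      show "quad h v = 0" if "h \<in> W" "dot (1, 0, 0) v = 0" for h v
      proof -
        obtain a b c d where h: "h = (a, b, c, d)" by (cases h)
        have "d = 0" using True that h by blast
        then have "a = 0" using polar(1) that h by fastforce
        then show ?thesis using that by (cases v) (simp add: h \<open>d = 0\<close>)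
      qed
    qed (auto simp: zero_prod_def)
  next
    case False
    then obtain a2 b2 c2 d2 where h2: "(a2, b2, c2, d2) \<in> W" "d2 \<noteq> 0" by blast
    obtain s where s: "b2 - c2 * b1 = \<i> * of_real s * cnj d2" "a2 = 2 * s * Im c2"
      using slope[OF h2] by blast
    show ?thesis
    \<comment> \<open>The condition says that elements with \<open>d = 0\<close> satisfy the slope
      equations for the slope \<open>s\<close> of the chosen element.\<close>
    proof (cases "\<forall>a b c. (a, b, c, 0) \<in> W \<longrightarrow> b = c * b1 \<and> s * Im c = 0")
      case True
      have a0: "a = 0" if "(a, b, c, 0) \<in> W" for a b c using polar(1)[OF that] by simp
      \<comment> \<open>If \<open>d\<close> is a real multiple of \<open>d2\<close>, subtracting
        reduces to \<open>d = 0\<close>. Otherwise the slope equation for the sum and real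
        independence of \<open>d\<close> and \<open>d2\<close> force equal slopes.\<close>
      have all: "b - c * b1 = \<i> * of_real s * cnj d \<and> a = 2 * s * Im c"
        if k: "(a, b, c, d) \<in> W" for a b c d
      proof (cases "\<exists>r. d = of_real r * d2")
        case True
        then obtain r where r: "d = of_real r * d2" by blast
        have m: "(a - r * a2, b - of_real r * b2, c - of_real r * c2, 0) \<in> W"
          using comb[OF k h2(1), of 1 "-r"] by (simp add: r)
        have "b - of_real r * b2 = (c - of_real r * c2) * b1" "s * Im (c - of_real r * c2) = 0"
          "a = r * a2"
          using \<open>\<forall>a b c. _\<close>[rule_format, OF m] a0[OF m] by simp_all
        then have "b - c * b1 = of_real r * (b2 - c2 * b1)" "a = 2 * s * Im c"
          by (auto simp: algebra_simps s(2))
        then show ?thesis by (simp add: r s(1))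
      next
        case False
        then have "d \<noteq> 0" using mult_zero_left[of d2] of_real_0 by metis
        have "d2 + d \<noteq> 0"
        proof
          assume "d2 + d = 0"
          then have "d = of_real (-1) * d2" by (simp add: add_eq_0_iff)
          then show False using False by blast
        qed
        obtain s' where s': "b - c * b1 = \<i> * of_real s' * cnj d" "a = 2 * s' * Im c"
          using slope[OF k \<open>d \<noteq> 0\<close>] by blast
        have "(a2 + a, b2 + b, c2 + c, d2 + d) \<in> W" using comb[OF h2(1) k, of 1 1] by simp
        then obtain s'' where "(b2 + b) - (c2 + c) * b1 = \<i> * of_real s'' * cnj (d2 + d)"
          using slope \<open>d2 + d \<noteq> 0\<close> by blast
        then have "(b2 - c2 * b1) + (b - c * b1) = \<i> * of_real s'' * cnj (d2 + d)"
          by (simp add: algebra_simps)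
        then have "\<i> * (of_real (s - s'') * cnj d2 + of_real (s' - s'') * cnj d) = 0"
          unfolding s(1) s'(1) by (simp add: algebra_simps)
        then have "cnj (of_real (s - s'') * d2 + of_real (s' - s'') * d) = 0" by simp
        then have *: "of_real (s - s'') * d2 + of_real (s' - s'') * d = 0"
          by (simp only: complex_cnj_zero_iff)
        have "s' = s''"
        proof (rule ccontr)
          assume "s' \<noteq> s''"
          then have "d = of_real (- (s - s'') / (s' - s'')) * d2"
            using * by (simp add: field_simps add_eq_0_iff)
          then show False using False by blast
        qed
        then have "s = s'" using * h2(2) by simp
        then show ?thesis using s' by simp
      qed
      \<comment> \<open>By \<open>all\<close> and \<open>polar\<close>, each form of
        \<open>W\<close> equals
        \<open>2 Re ((c * cnj x + d * cnj y) * (z + b1 * y - \<i> * s * x))\<close>; the second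
        factor is \<open>l\<close>.\<close>
      show ?thesis
      proof (rule isotropic_plane_case[OF W _ _ h0, where l = "(- \<i> * of_real s, b1, 1)"])
        show "quad h v = 0" if "h \<in> W" and v: "dot (- \<i> * of_real s, b1, 1) v = 0" for h v
        proof -
          obtain a b c d where h: "h = (a, b, c, d)" by (cases h)
          obtain x y z where xyz: "v = (x, y, z)" by (cases v)
          have z: "z = \<i> * of_real s * x - b1 * y" using v by (simp add: xyz algebra_simps)
          have a: "a = 2 * s * Im c" and b: "b = c * b1 + \<i> * of_real s * cnj d"
            using all[of a b c d] that(1) by (simp_all add: h diff_eq_eq)
          have "quad h v = (cmod x)\<^sup>2 * (a - 2 * s * Im c) - (cmod y)\<^sup>2 * (a + 2 * Re (b1 * d))"
            unfolding h xyz z b quad.simps cmod_power2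
            by (simp add: power2_eq_square algebra_simps)
          then show ?thesis using a polar(1) that(1) h by simp
        qed
      qed (auto simp: zero_prod_def)
    next
      case False
      then obtain a b c where k: "(a, b, c, 0) \<in> W" and nk: "b \<noteq> c * b1 \<or> s * Im c \<noteq> 0" by blast
      have "a = 0" using polar(1)[OF k] by simp
      \<comment> \<open>Adding or subtracting \<open>(a, b, c, 0)\<close> keeps the last entry
        \<open>d2\<close>, and the slopes become \<open>s + \<delta>\<close> and
        \<open>s - \<delta>\<close>. Comparing the resulting formulas for \<open>a2\<close>
        constrains \<open>\<delta>\<close> and \<open>Im c\<close>.\<close>
      obtain \<delta> where \<delta>: "b - c * b1 = \<i> * of_real \<delta> * cnj d2"
        and p: "a2 = 2 * (s + \<delta>) * (Im c2 + Im c)"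
      proof -
        have "(a2, b2 + b, c2 + c, d2) \<in> W" using comb[OF h2(1) k, of 1 1] \<open>a = 0\<close> by simp
        from slope[OF this h2(2)] obtain s' where
          s': "b2 + b - (c2 + c) * b1 = \<i> * of_real s' * cnj d2" "a2 = 2 * s' * Im (c2 + c)" by blast
        have "b - c * b1 = \<i> * of_real s' * cnj d2 - (b2 - c2 * b1)"
          unfolding s'(1)[symmetric] by (simp add: algebra_simps)
        then have "b - c * b1 = \<i> * of_real (s' - s) * cnj d2"
          unfolding s(1) by (simp add: algebra_simps)
        then show ?thesis using s'(2) that[of "s' - s"] by simp
      qed
      have m: "a2 = 2 * (s - \<delta>) * (Im c2 - Im c)"
      proof -
        have "(a2, b2 - b, c2 - c, d2) \<in> W" using comb[OF h2(1) k, of 1 "-1"] \<open>a = 0\<close> by simp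
        from slope[OF this h2(2)] obtain s' where
          s': "b2 - b - (c2 - c) * b1 = \<i> * of_real s' * cnj d2" "a2 = 2 * s' * Im (c2 - c)" by blast
        have "\<i> * of_real s' * cnj d2 = (b2 - c2 * b1) - (b - c * b1)"
          unfolding s'(1)[symmetric] by (simp add: algebra_simps)
        also have "\<dots> = \<i> * of_real (s - \<delta>) * cnj d2"
          unfolding s(1) \<delta> by (simp add: algebra_simps)
        finally have "s' = s - \<delta>" using h2(2) by (simp del: of_real_diff)
        then show ?thesis using s'(2) by simp
      qed
      have "s * Im c + \<delta> * Im c2 + \<delta> * Im c = 0" "s * Im c + \<delta> * Im c2 - \<delta> * Im c = 0"
        using p m s(2) by (simp_all add: algebra_simps)
      then have e: "\<delta> * Im c = 0" "s * Im c + \<delta> * Im c2 = 0" by linarith+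
      then have "\<delta> \<noteq> 0" using nk \<delta> by auto
      then have "Im c = 0" using e by simp
      \<comment> \<open>\<open>\<beta>\<close> is the entry \<open>b - c * b1\<close> left after
        subtracting the real multiple \<open>c\<close> of \<open>(0, b1, 1, 0)\<close>.\<close>
      define \<beta> where "\<beta> = \<i> * of_real \<delta> * cnj d2"
      have "\<beta> \<noteq> 0" using \<open>\<delta> \<noteq> 0\<close> h2(2) by (simp add: \<beta>_def)
      obtain r where r: "c = of_real r"
        using \<open>Im c = 0\<close> by (metis complex_is_Real_iff Reals_cases)
      have g1: "(0, \<beta>, 0, 0) \<in> W"
        using comb[OF k h1, of 1 "- r"] \<open>a = 0\<close> \<delta> by (simp add: \<beta>_def r)
      \<comment> \<open>Adding \<open>(0, \<beta>, 0, 0)\<close> changes the slope but neither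
        \<open>a\<close> nor \<open>c\<close>, so \<open>a = 2 * s * Im c\<close> forces
        \<open>Im c = 0\<close>; the change of slope also relates \<open>d\<close> to
        \<open>\<beta>\<close>.\<close>
      have nondeg: "a = 0 \<and> Im c = 0 \<and> (\<exists>t. d = of_real t * (\<i> * cnj \<beta>)) \<and>
          (\<exists>r. b - c * b1 = of_real r * \<beta>)" if h: "(a, b, c, d) \<in> W" and d: "d \<noteq> 0" for a b c d
      proof -
        obtain s where s: "b - c * b1 = \<i> * of_real s * cnj d" "a = 2 * s * Im c"
          using slope[OF h d] by blast
        have "(a, b + \<beta>, c, d) \<in> W" using comb[OF h g1, of 1 1] by simp
        then obtain s' where s': "b + \<beta> - c * b1 = \<i> * of_real s' * cnj d" "a = 2 * s' * Im c"
          using slope \<open>d \<noteq> 0\<close> by blast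
        have "\<beta> = \<i> * of_real s' * cnj d - (b - c * b1)"
          unfolding s'(1)[symmetric] by simp
        then have \<beta>: "\<beta> = \<i> * of_real (s' - s) * cnj d" unfolding s(1) by (simp add: algebra_simps)
        have "s' - s \<noteq> 0" using \<beta> \<open>\<beta> \<noteq> 0\<close> by auto
        have "(s' - s) * Im c = 0" using s(2) s'(2) by (simp add: algebra_simps)
        then have "Im c = 0" using \<open>s' - s \<noteq> 0\<close> by simp
        moreover have "d = of_real (1 / (s' - s)) * (\<i> * cnj \<beta>)"
          using \<open>s' - s \<noteq> 0\<close> unfolding \<beta> by (simp add: field_simps del: of_real_diff)
        moreover have "b - c * b1 = of_real (s / (s' - s)) * \<beta>"
          using \<open>s' - s \<noteq> 0\<close> unfolding \<beta> s(1) by (simp add: field_simps del: of_real_diff)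
        ultimately show ?thesis using s(2) by (metis mult_zero_right)
      qed
      have "a2 = 0" "Im c2 = 0" using nondeg[OF h2] by auto
      obtain t2 where t2: "d2 = of_real t2 * (\<i> * cnj \<beta>)" using nondeg[OF h2] by blast
      then have "t2 \<noteq> 0" using h2(2) by auto
      have "Re (b1 * d2) = 0" using polar(1)[OF h2(1)] \<open>a2 = 0\<close> by simp
      \<comment> \<open>Both \<open>b1\<close> and \<open>\<beta>\<close> are real multiples of
        \<open>\<i> * cnj d2\<close>.\<close>
      then obtain \<rho> where \<rho>: "b1 = of_real \<rho> * \<beta>"
      proof -
        have "Re (d2 * b1) = 0" using \<open>Re (b1 * d2) = 0\<close> by (simp add: mult.commute)
        from imaginary_product_imp_multiple[OF h2(2) this] obtain u where
          u: "b1 = \<i> * of_real u * cnj d2" by blast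
        have "b1 = - (\<i> * \<i>) * (of_real (u * t2) * \<beta>)"
          unfolding u t2 by (simp del: i_squared add: algebra_simps)
        then have "b1 = of_real (u * t2) * \<beta>" by simp
        then show ?thesis using that by blast
      qed
      have nondeg': "\<exists>r c' t. (a, b, c, d) = (0, of_real r * \<beta>, of_real c', of_real t * (\<i> * cnj \<beta>))"
        if h: "(a, b, c, d) \<in> W" and d: "d \<noteq> 0" for a b c d
      proof -
        obtain r t where *: "a = 0" "Im c = 0" "d = of_real t * (\<i> * cnj \<beta>)"
          "b - c * b1 = of_real r * \<beta>" using nondeg[OF h d] by blast
        then have c: "c = of_real (Re c)" by (simp add: complex_eq_iff)
        have "b = of_real r * \<beta> + c * b1" using *(4) by (simp add: algebra_simps)
        also have "\<dots> = of_real (r + Re c * \<rho>) * \<beta>"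
          unfolding \<rho> by (subst c) (simp add: algebra_simps)
        finally show ?thesis using * c by blast
      qed
      have g2: "(0, 0, 1, 0) \<in> W" using comb[OF h1 g1, of 1 "- \<rho>"] by (simp add: \<rho>)
      have c2: "c2 = of_real (Re c2)" using \<open>Im c2 = 0\<close> by (simp add: complex_eq_iff)
      obtain r3 where "b2 = of_real r3 * \<beta>" using nondeg'[OF h2] by blast
      then have "(0, 0, c2, d2) \<in> W" using comb[OF h2(1) g1, of 1 "- r3"] \<open>a2 = 0\<close> by simp
      from comb[OF this g2, of 1 "- Re c2"] have "(0, 0, 0, d2) \<in> W"
        using c2 by simp
      from comb[OF this g2, of "1 / t2" 0] have g3: "(0, 0, 0, \<i> * cnj \<beta>) \<in> W"
        using \<open>t2 \<noteq> 0\<close> by (simp add: t2)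
      show ?thesis
      proof (rule real_plane_case[OF W \<open>\<beta> \<noteq> 0\<close> g1 g2 g3 _ h0])
        fix h assume "h \<in> W"
        obtain a b c d where h: "h = (a, b, c, d)" by (cases h)
        show "\<exists>r c t. h = (0, of_real r * \<beta>, of_real c, of_real t * (\<i> * cnj \<beta>))"
        proof (cases "d = 0")
          case False
          then show ?thesis using nondeg' \<open>h \<in> W\<close> h by blast
        next
          case True
          \<comment> \<open>Adding the element with last entry \<open>d2\<close> moves an element
            with \<open>d = 0\<close> into the range of \<open>nondeg'\<close>.\<close>
          have "(a2 + a, b2 + b, c2 + c, d2) \<in> W"
            using comb[OF h2(1) \<open>h \<in> W\<close>[unfolded h], of 1 1] True by simp
          from nondeg'[OF this h2(2)] obtain r' c' where *: "a2 + a = 0" "b2 + b = of_real r' * \<beta>"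
            "c2 + c = of_real c'" by blast
          have "b = of_real (r' - r3) * \<beta>" "c = of_real (c' - Re c2)"
            using *(2,3) c2 \<open>b2 = _\<close> by (simp_all add: algebra_simps eq_diff_eq)
          moreover have "a = 0" using * \<open>a2 = 0\<close> by simp
          ultimately show ?thesis using True h by (metis mult_zero_left of_real_0)
        qed
      qed
    qed
  qed
qed

section \<open>Bases, dimensions and positivity\<close>

context complex_space_3
begin

lemma exists_notin_span:
  assumes "finite A" "card A < 3"
  obtains w where "w \<notin> span A"
proof -
  have "dim (UNIV :: 'v set) \<le> card A" if "span A = UNIV"
    using dim_le_card[of UNIV A] that assms(1) by simp
  then show ?thesis using assms(2) dim_UNIV that by fastforce
qed

lemma independent_is_basis:
  assumes "inj b" "independent (range b)"
  shows "is_basis b"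
proof -
  obtain c where c: "is_basis c" using ex_is_basis by blast
  interpret finite_dimensional_vector_space scale "range c"
    using is_basisD[OF c] by unfold_locales auto
  have "card (range b) = 3" "card (range c) = 3"
    using card_image[OF assms(1)] card_image[OF is_basisD(1)[OF c]] by simp_all
  then have "UNIV \<subseteq> span (range b)"
    using card_ge_dim_independent[of "range b" UNIV] assms(2) dim_UNIV by simp
  then show ?thesis using assms by (auto simp: is_basis_def)
qed

text \<open>Injectivity on \<open>W\<close> keeps the image of a basis of \<open>W\<close>
  independent. This carries the dimension of a family over to its space of forms.\<close>

lemma map_space_dim_image:
  fixes f :: "('v \<Rightarrow> 'v) \<Rightarrow> 'b::real_vector"
  assumes W: "map_space.subspace W" and f: "Vector_Spaces.linear (map_scaleR scale) scaleR f"
    and inj: "inj_on f W"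
  shows "Real_Vector_Spaces.dim (f ` W) = map_space.dim W"
proof -
  interpret f: Vector_Spaces.linear "map_scaleR scale" scaleR f by (rule f)
  obtain B where B: "B \<subseteq> W" "map_space.independent B" "W \<subseteq> map_space.span B"
    "card B = map_space.dim W" using map_space.basis_exists by blast
  have span: "map_space.span B = W"
    using map_space.span_minimal[OF B(1) W] B(3) by blast
  have ind: "\<not> module.dependent scaleR (f ` B)"
    using f.independent_injective_image[OF B(2)] inj span by simp
  have "map_space.span W = W" using W by simp
  then have "module.span scaleR (f ` B) = module.span scaleR (f ` W)"
    using f.span_image[of B] f.span_image[of W] span by (simp only:)
  then have "Real_Vector_Spaces.dim (f ` W) = card (f ` B)"
    using ind unfolding dim_raw_def by (rule vector_space.dim_eq_card[OF real_vector.vector_space_axioms])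
  then show ?thesis using card_image[OF inj_on_subset[OF inj B(1)]] B(4) by simp
qed

end

text \<open>Lagrange's identity: the difference of the two sides is
  \<open>(cmod (x1 * p2 - x2 * p1))^2\<close>.\<close>

lemma cauchy_schwarz_complex_pair:
  "(cmod (x1 * cnj p1 + x2 * cnj p2))\<^sup>2 \<le> ((cmod x1)\<^sup>2 + (cmod x2)\<^sup>2) * ((cmod p1)\<^sup>2 + (cmod p2)\<^sup>2)"
proof -
  have "((cmod x1)\<^sup>2 + (cmod x2)\<^sup>2) * ((cmod p1)\<^sup>2 + (cmod p2)\<^sup>2)
    = (cmod (x1 * cnj p1 + x2 * cnj p2))\<^sup>2 + (cmod (x1 * p2 - x2 * p1))\<^sup>2"
    by (simp add: cmod_power2) (simp add: power2_eq_square algebra_simps)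
  then show ?thesis by simp
qed

context hermitian_space_21
begin

lemma herm_diff_left: "herm (x - y) z = herm x z - herm y z"
  using herm_add_left[of "x - y" y z] by simp

lemma herm_diff_right: "herm z (x - y) = herm z x - herm z y"
  using herm_add_right[of z "x - y" y] by simp

lemmas herm_simps = herm_add_left herm_add_right herm_diff_left herm_diff_right
  herm_scale_left herm_scale_right herm_0_left herm_0_right

lemma herm_self: "herm v v = of_real (Re (herm v v))"
  using herm_commute[of v v] by (simp add: complex_eq_iff)

text \<open>Write \<open>X - x\<close> and \<open>P - q\<close> for the norms of \<open>v\<close>
  and \<open>p\<close> in a basis of signature \<open>++-\<close>. Orthogonality and Cauchy-Schwarz
  give \<open>x * q \<le> X * P\<close>, while \<open>P < q\<close>; so \<open>X \<le> x\<close>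
  would force \<open>x = X = 0\<close> and \<open>v = 0\<close>.\<close>

lemma herm_orthogonal_positive:
  assumes p: "Re (herm p p) < 0" and "herm v p = 0" "v \<noteq> 0"
  shows "Re (herm v v) > 0"
proof -
  obtain b :: "3 \<Rightarrow> 'v" where b: "is_basis b"
    and hb: "\<And>i j. herm (b i) (b j) = (if i \<noteq> j then 0 else if i = 3 then - 1 else 1)"
    using signature by blast
  define c where "c v i = representation (range b) v (b i)" for v i
  have exp: "v = scale (c v 1) (b 1) + scale (c v 2) (b 2) + scale (c v 3) (b 3)" for v
    using basis_expand[OF b, of v] by (simp add: c_def sum_3)
  have herm: "herm v w = c v 1 * cnj (c w 1) + c v 2 * cnj (c w 2) - c v 3 * cnj (c w 3)" for v w
    by (subst exp[of v], subst exp[of w]) (simp add: herm_simps hb)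
  have self: "Re (herm v v) = (cmod (c v 1))\<^sup>2 + (cmod (c v 2))\<^sup>2 - (cmod (c v 3))\<^sup>2" for v
    by (simp add: herm cmod_power2 flip: power2_eq_square)
  define X where "X = (cmod (c v 1))\<^sup>2 + (cmod (c v 2))\<^sup>2"
  define P where "P = (cmod (c p 1))\<^sup>2 + (cmod (c p 2))\<^sup>2"
  define x where "x = (cmod (c v 3))\<^sup>2"
  define q where "q = (cmod (c p 3))\<^sup>2"
  have "P < q" using p by (simp add: self P_def q_def)
  have "P \<ge> 0" "X \<ge> 0" "x \<ge> 0" by (simp_all add: P_def X_def x_def)
  have "c v 1 * cnj (c p 1) + c v 2 * cnj (c p 2) = c v 3 * cnj (c p 3)"
    using \<open>herm v p = 0\<close> by (simp add: herm)
  then have "x * q \<le> X * P"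
    using cauchy_schwarz_complex_pair[of "c v 1" "c p 1" "c v 2" "c p 2"]
    by (simp add: x_def q_def X_def P_def norm_mult power_mult_distrib)
  have "x < X"
  proof (rule ccontr)
    assume "\<not> x < X"
    then have "X * P \<le> x * P" using \<open>P \<ge> 0\<close> by (simp add: mult_right_mono)
    then have "x * (q - P) \<le> 0" using \<open>x * q \<le> X * P\<close> by (simp add: algebra_simps)
    then have "x = 0" using \<open>P < q\<close> \<open>x \<ge> 0\<close> by (simp add: mult_le_0_iff)
    then have "X = 0" using \<open>X \<ge> 0\<close> \<open>\<not> x < X\<close> by simp
    then have "c v 1 = 0" "c v 2 = 0" "c v 3 = 0"
      using \<open>x = 0\<close> by (auto simp: X_def x_def add_nonneg_eq_0_iff)
    then show False using exp[of v] \<open>v \<noteq> 0\<close> by simp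
  qed
  then show ?thesis by (simp add: self X_def x_def)
qed

lemma normalize_positive:
  assumes "Re (herm v v) > 0"
  obtains r where "r \<noteq> 0" "herm (scale (of_real r) v) (scale (of_real r) v) = 1"
proof
  have "herm (scale (of_real r) v) (scale (of_real r) v) = of_real (r\<^sup>2 * Re (herm v v))" for r
    by (subst herm_scale_left, subst herm_scale_right, subst herm_self) (simp add: power2_eq_square)
  moreover have "(1 / sqrt (Re (herm v v)))\<^sup>2 * Re (herm v v) = 1"
    using assms by (simp add: power_divide)
  ultimately show "herm (scale (of_real (1 / sqrt (Re (herm v v)))) v)
      (scale (of_real (1 / sqrt (Re (herm v v)))) v) = 1" by (metis of_real_1)
qed (use assms in simp)

end

section \<open>Selfadjoint maps as forms in an orthonormal frame\<close>

locale orthonormal_frame = hermitian_space_21 scale herm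
  for scale :: "complex \<Rightarrow> 'v::ab_group_add \<Rightarrow> 'v" and herm +
  fixes e1 e2 e3 :: 'v
  assumes frame_self: "herm e1 e1 = 1" "herm e2 e2 = 1" "herm e3 e3 = - 1"
    and frame_orth: "herm e1 e2 = 0" "herm e1 e3 = 0" "herm e2 e3 = 0"
begin

lemma frame_orth': "herm e2 e1 = 0" "herm e3 e1 = 0" "herm e3 e2 = 0"
  using frame_orth herm_commute[of e2 e1] herm_commute[of e3 e1] herm_commute[of e3 e2] by simp_all

definition frame :: "3 \<Rightarrow> 'v"
  where "frame i = (if i = 1 then e1 else if i = 2 then e2 else e3)"

lemma herm_frame: "herm (frame i) (frame j) = (if i \<noteq> j then 0 else if i = 3 then - 1 else 1)"
  using exhaust_3[of i] exhaust_3[of j]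
  by (auto simp: frame_def frame_self frame_orth frame_orth')

lemma frame_is_basis: "is_basis frame"
proof (rule independent_is_basis)
  show inj: "inj frame"
  proof
    fix i j assume "frame i = frame j"
    then have "herm (frame i) (frame i) = herm (frame i) (frame j)" by simp
    then show "i = j" by (auto simp: herm_frame split: if_splits)
  qed
  show "independent (range frame)"
  proof (rule independent_if_scalars_zero)
    fix f x assume 0: "(\<Sum>x\<in>range frame. scale (f x) x) = 0" and "x \<in> range frame"
    then obtain i where i: "x = frame i" by blast
    have "0 = herm (\<Sum>j\<in>UNIV. scale (f (frame j)) (frame j)) (frame i)"
      using 0 inj by (simp add: sum.reindex herm_0_left)
    also have "\<dots> = (\<Sum>j\<in>UNIV. if j = i then f (frame j) * (if i = 3 then - 1 else 1) else 0)"
      unfolding herm_sum_left herm_scale_left herm_frame by (intro sum.cong) auto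
    finally show "f x = 0" by (simp add: i split: if_splits)
  qed simp
qed

lemma frame_expand: "v = scale (herm v e1) e1 + scale (herm v e2) e2 - scale (herm v e3) e3"
proof -
  define c where "c i = representation (range frame) v (frame i)" for i
  have v: "v = scale (c 1) e1 + scale (c 2) e2 + scale (c 3) e3"
    using basis_expand[OF frame_is_basis, of v] by (simp add: c_def sum_3 frame_def)
  have "herm v e1 = c 1" "herm v e2 = c 2" "herm v e3 = - c 3"
    by (subst v, simp add: herm_simps frame_self frame_orth frame_orth')+
  then show ?thesis using v by simp
qed

lemma representation_frame:
  "representation (range frame) v (frame i) = (if i = 3 then - 1 else 1) * herm v (frame i)"
proof -
  have "herm v (frame i) = herm (\<Sum>j\<in>UNIV. scale (representation (range frame) v (frame j)) (frame j)) (frame i)"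
    by (simp add: basis_expand[OF frame_is_basis])
  also have "\<dots> = (\<Sum>j\<in>UNIV. if j = i then representation (range frame) v (frame j) *
      (if i = 3 then - 1 else 1) else 0)"
    unfolding herm_sum_left herm_scale_left herm_frame by (intro sum.cong) auto
  finally show ?thesis by simp
qed

text \<open>For a \<open>bisector_map\<close> the remaining entries of the hermitian matrix follow
  from selfadjointness, zero trace and the zero entry at \<open>e3\<close>.\<close>

definition form_of :: "('v \<Rightarrow> 'v) \<Rightarrow> form"
  where "form_of h = (Re (herm (h e1) e1), herm (h e2) e1, herm (h e3) e1, herm (h e3) e2)"

fun vec_of :: "complex \<times> complex \<times> complex \<Rightarrow> 'v"
  where "vec_of (x, y, z) = scale x e1 + scale y e2 + scale z e3"

lemma vec_of_surj: obtains w where "vec_of w = v"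
  using frame_expand[of v] that[of "(herm v e1, herm v e2, - herm v e3)"] by simp

lemma form_of_linear: "Vector_Spaces.linear (map_scaleR scale) scaleR form_of"
proof (intro Vector_Spaces.linear.intro module_hom.intro module_hom_axioms.intro)
  show "form_of (g + h) = form_of g + form_of h" for g h
    by (simp add: form_of_def herm_add_left)
  show "form_of (map_scaleR scale r h) = r *\<^sub>R form_of h" for r h
    by (simp add: form_of_def map_scaleR_def herm_scale_left scaleR_conv_of_real)
qed unfold_locales

definition bisector_map :: "('v \<Rightarrow> 'v) \<Rightarrow> bool"
  where "bisector_map h \<longleftrightarrow> h \<in> Lin \<and> map_trace h = 0 \<and> herm_adjoint h = h \<and> herm (h e3) e3 = 0"

context
  fixes h assumes h: "bisector_map h"
begin

lemma bisector_map_adjoint: "herm (h x) y = herm x (h y)"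
  using herm_adjoint(2)[of h x y] h by (simp add: bisector_map_def)

lemma bisector_map_linear: "h (x + y) = h x + h y" "h (scale c x) = scale c (h x)"
proof -
  interpret h: Vector_Spaces.linear scale scale h using h by (simp add: bisector_map_def Lin_def)
  show "h (x + y) = h x + h y" "h (scale c x) = scale c (h x)" by (simp_all add: h.add h.scale)
qed

lemma herm_bisector_map:
  assumes "form_of h = (a, b, c, d)"
  shows "herm (h e1) e1 = of_real a" "herm (h e2) e2 = - of_real a" "herm (h e3) e3 = 0"
    "herm (h e2) e1 = b" "herm (h e1) e2 = cnj b" "herm (h e3) e1 = c" "herm (h e1) e3 = cnj c"
    "herm (h e3) e2 = d" "herm (h e2) e3 = cnj d"
proof -
  show "herm (h e2) e1 = b" "herm (h e3) e1 = c" "herm (h e3) e2 = d"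
    using assms by (simp_all add: form_of_def)
  then show "herm (h e1) e2 = cnj b" "herm (h e1) e3 = cnj c" "herm (h e2) e3 = cnj d"
    by (metis bisector_map_adjoint herm_commute)+
  show e3: "herm (h e3) e3 = 0" using h by (simp add: bisector_map_def)
  have "herm (h e1) e1 = cnj (herm (h e1) e1)" by (metis bisector_map_adjoint herm_commute)
  then show a: "herm (h e1) e1 = of_real a"
    using assms by (simp add: form_of_def complex_eq_iff)
  have "map_trace h = herm (h e1) e1 + herm (h e2) e2 - herm (h e3) e3"
    using map_trace_eq[OF frame_is_basis, of h] h
    by (simp add: bisector_map_def trace_def map_matrix_def sum_3 representation_frame, simp add: frame_def)
  then show "herm (h e2) e2 = - of_real a"
    using h e3 by (simp add: bisector_map_def a add_eq_0_iff)
qed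

lemma quad_form_of: "herm (h (vec_of v)) (vec_of v) = of_real (quad (form_of h) v)"
proof -
  obtain a b c d where f: "form_of h = (a, b, c, d)" by (cases "form_of h")
  obtain x y z where v: "v = (x, y, z)" by (cases v)
  show ?thesis
    by (simp add: v f bisector_map_linear herm_simps herm_bisector_map[OF f] complex_eq_iff cmod_power2)
      (simp add: power2_eq_square algebra_simps)
qed

text \<open>The sign comes from \<open>herm e3 e3 = - 1\<close>: the third row of the matrix of
  \<open>h\<close> is minus that of the hermitian matrix.\<close>

lemma map_det_form_of: "map_det h = - of_real (disc (form_of h))"
proof -
  obtain a b c d where f: "form_of h = (a, b, c, d)" by (cases "form_of h")
  have "map_det h = det (map_matrix frame h)"
    using map_det_eq[OF frame_is_basis] h by (simp add: bisector_map_def)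
  also have "\<dots> = - (of_real a * (c * cnj c - d * cnj d) + b * cnj c * d + cnj (b * cnj c * d))"
    by (simp add: det_3 map_matrix_def representation_frame, simp add: frame_def herm_bisector_map[OF f] algebra_simps)
  finally show ?thesis
    by (simp add: f complex_norm_square[symmetric] complex_eq_iff algebra_simps)
qed

lemma bisector_map_frame:
  assumes "form_of h = (a, b, c, d)"
  shows "h e1 = scale (of_real a) e1 + scale (cnj b) e2 - scale (cnj c) e3"
    "h e2 = scale b e1 + scale (- of_real a) e2 - scale (cnj d) e3"
    "h e3 = scale c e1 + scale d e2"
  using frame_expand[of "h e1"] frame_expand[of "h e2"] frame_expand[of "h e3"]
  by (simp_all only: herm_bisector_map[OF assms] scale_zero_left diff_zero)

end

lemma form_of_inject:
  assumes "bisector_map g" "bisector_map h" "form_of g = form_of h"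
  shows "g = h"
proof
  fix v
  obtain w where w: "vec_of w = v" using vec_of_surj by blast
  obtain x y z where xyz: "w = (x, y, z)" by (cases w)
  obtain a b c d where f: "form_of h = (a, b, c, d)" by (cases "form_of h")
  show "g v = h v"
    unfolding w[symmetric] xyz vec_of.simps bisector_map_linear[OF assms(1)] bisector_map_linear[OF assms(2)]
    using assms f by (simp add: bisector_map_frame[OF assms(1)] bisector_map_frame[OF assms(2)])
qed

text \<open>The first alternative of \<open>cases\<close> feeds \<open>nonzero_column_case\<close>,
  the second \<open>negative_focus_case\<close>; injectivity of \<open>form_of\<close> leads back to
  maps.\<close>

lemma family_determined_by_base:
  assumes W: "map_space.subspace W" and bis: "\<And>h. h \<in> W \<Longrightarrow> bisector_map h"
    and det: "\<And>h. h \<in> W \<Longrightarrow> map_det h = 0"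
    and cases: "(0, b1, 1, 0) \<in> form_of ` W \<or> (\<forall>h\<in>W. h e3 = 0) \<and> (a1, b1, 0, 0) \<notin> form_of ` W"
    and h0: "h0 \<in> Lin" "map_trace h0 = 0" "herm_adjoint h0 = h0"
    and van: "\<And>p v. p \<in> base W \<Longrightarrow> v \<in> p \<Longrightarrow> herm (h0 v) v = 0"
  shows "h0 \<in> W"
proof -
  \<comment> \<open>A common zero \<open>v \<noteq> 0\<close> spans a point of the base, so
    \<open>van\<close> becomes a statement about vectors.\<close>
  have *: "herm (h0 v) v = 0" if 0: "\<And>h. h \<in> W \<Longrightarrow> herm (h v) v = 0" for v
  proof (cases "v = 0")
    case True then show ?thesis by (simp add: herm_0_right)
  next
    case False
    have "span {v} \<in> base W"
    proof -
      have "herm (h w) w = 0" if "h \<in> W" "w \<in> span {v}" for h w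
      proof -
        obtain k where w: "w = scale k v" using \<open>w \<in> span {v}\<close> by (auto simp: span_singleton)
        show ?thesis using 0[OF that(1)]
          by (simp add: w bisector_map_linear[OF bis[OF that(1)]] herm_simps)
      qed
      then show ?thesis using False by (auto simp: base_def proj_points_def)
    qed
    then show ?thesis using van span_base by blast
  qed
  have "herm (h0 e3) e3 = 0" using * bis by (auto simp: bisector_map_def)
  then have bis0: "bisector_map h0" using h0 by (simp add: bisector_map_def)
  interpret f: Vector_Spaces.linear "map_scaleR scale" scaleR form_of by (rule form_of_linear)
  have W': "real_vector.subspace (form_of ` W)" 
    unfolding subspace_raw_def by (rule f.subspace_image[OF W])
  have disc: "disc f = 0" if "f \<in> form_of ` W" for f
    using that det bis map_det_form_of by auto
  have quad: "quad (form_of h0) v = 0" if "\<And>f. f \<in> form_of ` W \<Longrightarrow> quad f v = 0" for v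
  proof -
    have "herm (h0 (vec_of v)) (vec_of v) = 0"
      using that by (intro *) (simp add: quad_form_of[OF bis])
    then show ?thesis by (simp add: quad_form_of[OF bis0])
  qed
  have "form_of h0 \<in> form_of ` W"
    using cases
  proof
    assume "(0, b1, 1, 0) \<in> form_of ` W"
    then show ?thesis using nonzero_column_case[OF W' disc _ quad] by blast
  next
    assume A: "(\<forall>h\<in>W. h e3 = 0) \<and> (a1, b1, 0, 0) \<notin> form_of ` W"
    have "c = 0 \<and> d = 0" if "(a, b, c, d) \<in> form_of ` W" for a b c d
      using that A by (auto simp: form_of_def herm_0_left)
    then show ?thesis using negative_focus_case[OF W' _ _ quad] A by blast
  qed
  then obtain h where "h \<in> W" "form_of h0 = form_of h" by blast
  then show ?thesis using form_of_inject[OF bis0 bis] by simp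
qed

text \<open>The forms \<open>(a, b, 0, 0)\<close> are a copy of the real space R x C.
  Contrapositively, this yields the missing form for the focus case.\<close>

lemma map_space_dim_full_focus:
  assumes W: "map_space.subspace W" and bis: "\<And>h. h \<in> W \<Longrightarrow> bisector_map h"
    and foc: "\<And>h. h \<in> W \<Longrightarrow> h e3 = 0" and full: "\<And>a b. (a, b, 0, 0) \<in> form_of ` W"
  shows "map_space.dim W = 3"
proof -
  have "form_of ` W = UNIV \<times> UNIV \<times> {0}"
  proof
    show "form_of ` W \<subseteq> UNIV \<times> UNIV \<times> {0}"
      using foc by (auto simp: form_of_def zero_prod_def) (metis herm_0_left)+
    show "UNIV \<times> UNIV \<times> {0} \<subseteq> form_of ` W"
      using full by (auto simp: zero_prod_def)
  qed
  moreover have "inj_on form_of W" using form_of_inject bis by (auto intro!: inj_onI)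
  ultimately have "map_space.dim W = Real_Vector_Spaces.dim (UNIV \<times> UNIV \<times> {0} :: form set)"
    using map_space_dim_image[OF W form_of_linear] by simp
  also have "\<dots> = 3"
    by (simp add: dim_Times subspace_Times)
  finally show ?thesis .
qed

end

section \<open>Frames at a negative base point and the conclusion\<close>

context hermitian_space_21
begin

text \<open>Gram-Schmidt inside the positive definite complement of \<open>p\<close>. The factor on
  \<open>v\<close> is real so that, for \<open>v = h p\<close>, the rescaled map stays in the real
  space \<open>W\<close>.\<close>

lemma extend_to_frame:
  assumes p: "herm p p = - 1" and v: "herm v p = 0" "v \<noteq> 0"
  obtains r e2 where "r \<noteq> 0" "orthonormal_frame scale herm (scale (of_real r) v) e2 p"
proof -
  obtain r where r: "r \<noteq> 0" "herm (scale (of_real r) v) (scale (of_real r) v) = 1"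
    using normalize_positive herm_orthogonal_positive[of p v] p v by auto
  define u where "u = scale (of_real r) v"
  have u: "herm u u = 1" "herm u p = 0" "herm p u = 0"
    using r v herm_commute[of p u] by (simp_all add: u_def herm_simps)
  have "card {u, p} < 3" by (simp add: card_insert_if)
  then obtain w where w: "w \<notin> span {u, p}" using exists_notin_span[of "{u, p}"] by auto
  define n where "n = w - scale (herm w u) u + scale (herm w p) p"
  have n: "herm n u = 0" "herm n p = 0" by (simp_all add: n_def herm_simps u p)
  have "n \<noteq> 0"
  proof
    assume "n = 0"
    then have "w = scale (herm w u) u - scale (herm w p) p" by (simp add: n_def algebra_simps)
    moreover have "scale (herm w u) u - scale (herm w p) p \<in> span {u, p}"
      by (intro span_diff span_scale span_base) auto
    ultimately show False using w by simp
  qed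
  then obtain t where t: "t \<noteq> 0" "herm (scale (of_real t) n) (scale (of_real t) n) = 1"
    using normalize_positive herm_orthogonal_positive[of p n] p n by auto
  have "herm u n = 0" using n herm_commute[of u n] by simp
  then have "orthonormal_frame scale herm u (scale (of_real t) n) p"
    using u n t p by unfold_locales (simp_all add: herm_simps)
  then show ?thesis using r that by (simp add: u_def)
qed

lemma ex_negative_unit:
  assumes "f \<in> negative_points"
  obtains p where "p \<in> f" "f = span {p}" "herm p p = - 1"
proof -
  obtain v where v: "f = span {v}" "v \<noteq> 0" using assms by (auto simp: negative_points_def proj_points_def)
  then have neg: "Re (herm v v) < 0" using assms span_base by (auto simp: negative_points_def)
  define r where "r = 1 / sqrt (- Re (herm v v))"
  have "r \<noteq> 0" using neg by (simp add: r_def)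
  have "herm (scale (of_real r) v) (scale (of_real r) v) = of_real (r\<^sup>2 * Re (herm v v))"
    by (subst herm_scale_left, subst herm_scale_right, subst herm_self) (simp add: power2_eq_square)
  also have "r\<^sup>2 * Re (herm v v) = - 1" using neg by (simp add: r_def power_divide)
  finally have "herm (scale (of_real r) v) (scale (of_real r) v) = - 1" by simp
  moreover have "span {scale (of_real r) v} = f"
    using span_image_scale[of "{v}" "\<lambda>_. of_real r"] \<open>r \<noteq> 0\<close> v by simp
  ultimately show ?thesis using that span_base by blast
qed

lemma linear_family_determined_by_base:
  assumes lin: "linear_family W"
    and nf: "\<And>f. f \<in> negative_points \<Longrightarrow> confocal_family W f \<Longrightarrow> family_dim W \<noteq> 3"
    and h0: "h0 \<in> Lin" "map_trace h0 = 0" "herm_adjoint h0 = h0"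
    and van: "\<And>p v. p \<in> base W \<Longrightarrow> v \<in> p \<Longrightarrow> herm (h0 v) v = 0"
  shows "h0 \<in> W"
proof -
  have W: "W \<subseteq> Lin" "map_space.subspace W" and bis: "\<And>h. h \<in> W \<Longrightarrow> map_trace h = 0 \<and> herm_adjoint h = h"
    and det: "\<And>h. h \<in> W \<Longrightarrow> map_det h = 0"
    using lin by (auto simp: linear_family_def bisector_family_def degenerate_part_def)
  obtain f where f: "f \<in> base W" "f \<in> negative_points"
    using lin by (auto simp: linear_family_def bisector_family_def)
  obtain p where p: "p \<in> f" "f = span {p}" "herm p p = - 1" using ex_negative_unit[OF f(2)] .
  have van_p: "herm (h p) p = 0" if "h \<in> W" for h using f(1) p(1) that by (auto simp: base_def)
  show ?thesis
  proof (cases "\<forall>h\<in>W. h p = 0")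
    case False
    then obtain h where h: "h \<in> W" "h p \<noteq> 0" by blast
    obtain r e2 where r: "r \<noteq> 0" and fr: "orthonormal_frame scale herm (scale (of_real r) (h p)) e2 p"
      using extend_to_frame[OF p(3) van_p[OF h(1)] h(2)] .
    interpret F: orthonormal_frame scale herm "scale (of_real r) (h p)" e2 p by (rule fr)
    have bisW: "F.bisector_map h" if "h \<in> W" for h
      using W bis van_p that by (auto simp: F.bisector_map_def)
    define k where "k = map_scaleR scale r h"
    have k: "k \<in> W" using map_space.subspace_scale[OF W(2) h(1)] by (simp add: k_def)
    obtain a b c d where form: "F.form_of k = (a, b, c, d)" by (cases "F.form_of k")
    have "k p = scale (of_real r) (h p)" by (simp add: k_def map_scaleR_def)
    then have cd: "c = 1" "d = 0"
      using form F.frame_self F.frame_orth by (simp_all add: F.form_of_def)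
    \<comment> \<open>With \<open>c = 1\<close> and \<open>d = 0\<close> the determinant of the form
      is \<open>a\<close>, so singularity gives \<open>a = 0\<close>.\<close>
    have "complex_of_real (disc (F.form_of k)) = 0"
      using F.map_det_form_of[OF bisW[OF k]] det[OF k] by simp
    then have "disc (a, b, c, d) = 0" by (simp only: of_real_eq_0_iff form)
    then have "(0, b, 1, 0) \<in> F.form_of ` W"
      using form k by (auto simp: cd intro: rev_image_eqI)
    then show ?thesis
      by (intro F.family_determined_by_base[OF W(2) bisW det _ h0 van] disjI1)
  next
    case True
    obtain w where w: "w \<notin> span {p}" using exists_notin_span[of "{p}"] by auto
    \<comment> \<open>The plus sign makes \<open>v\<close> orthogonal to \<open>p\<close> because
      \<open>herm p p = - 1\<close>. Since all of \<open>W\<close> kills \<open>p\<close>, any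
      direction of the complement may serve as first frame vector.\<close>
    define v where "v = w + scale (herm w p) p"
    have "herm v p = 0" by (simp add: v_def herm_simps p)
    moreover have "v \<noteq> 0"
    proof
      assume "v = 0"
      then have "w = scale (- herm w p) p" by (simp add: v_def add_eq_0_iff)
      then show False using w span_scale[OF span_base, of p "{p}"] by (metis singletonI)
    qed
    ultimately obtain r e2 where fr: "orthonormal_frame scale herm (scale (of_real r) v) e2 p"
      using extend_to_frame[OF p(3)] by blast
    interpret F: orthonormal_frame scale herm "scale (of_real r) v" e2 p by (rule fr)
    have bisW: "F.bisector_map h" if "h \<in> W" for h
      using W bis van_p that by (auto simp: F.bisector_map_def)
    have "confocal_family W f"
    proof -
      have "h x = 0" if "h \<in> W" "x \<in> f" for h x
        using that True by (auto simp: p(2) span_singleton F.bisector_map_linear[OF bisW])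
      then show ?thesis using lin f by (auto simp: confocal_family_def negative_points_def)
    qed
    then have "map_space.dim W \<noteq> 3" using nf f(2) by (auto simp: family_dim_def)
    then obtain a b where "(a, b, 0, 0) \<notin> F.form_of ` W"
      using F.map_space_dim_full_focus[OF W(2) bisW] True by blast
    then show ?thesis
      using True by (intro F.family_determined_by_base[OF W(2) bisW det _ h0 van] disjI2 conjI)
  qed
qed

end

theorem proposition1p2p4:
  fixes scl :: "complex \<Rightarrow> 'v::ab_group_add \<Rightarrow> 'v"
    and herm :: "'v \<Rightarrow> 'v \<Rightarrow> complex"
    and W :: "('v \<Rightarrow> 'v) set"
  assumes "hermitian_space_21 scl herm"
    and "hermitian_space_21.linear_family scl herm W"
    and "\<not> (\<exists>f \<in> hermitian_space_21.negative_points scl herm.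
               hermitian_space_21.confocal_family scl herm W f \<and>
               hermitian_space_21.family_dim scl W \<in> {3, 4})"
  shows "W = {h \<in> complex_space_3.Lin scl.
               complex_space_3.map_trace scl h = 0 \<and>
               hermitian_space_21.herm_adjoint scl herm h = h \<and>
               (\<forall>p \<in> hermitian_space_21.base scl herm W. \<forall>v\<in>p. herm (h v) v = 0)}"
proof -
  interpret hermitian_space_21 scl herm by (rule assms(1))
  have "h \<in> Lin \<and> map_trace h = 0 \<and> herm_adjoint h = h \<and> (\<forall>p\<in>base W. \<forall>v\<in>p. herm (h v) v = 0)"
    if "h \<in> W" for h
    using assms(2) that by (auto simp: linear_family_def bisector_family_def base_def)
  moreover have "h \<in> W" if "h \<in> Lin" "map_trace h = 0" "herm_adjoint h = h"
    "\<forall>p\<in>base W. \<forall>v\<in>p. herm (h v) v = 0" for h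
    using linear_family_determined_by_base[OF assms(2) _ that(1-3)] that(4) assms(3) by blast
  ultimately show ?thesis by blast
qed

end
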